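(* Let $\wp(z):=\wp(z;0,-4)$ be the Weierstrass function with invariants $g_2=0$ and $g_3=-4$. Its smallest positive real period, denoted $6r$, is $$6r=\pi_3\,2^{-1/3}=\frac{2^{-4/3}3^{1/2}}{\pi}\,\Gamma\!\left(\tfrac13\right)^3,$$ and the exponential generating function $f(z)=\sum_{n\ge0}\alpha_n\frac{z^n}{n!}$ of the pseudo-factorials satisfies $$f(i\sqrt3\,z)=\frac{-\wp'(z+3r)-2i\sqrt3}{2i\sqrt3\,\wp(z+3r)}$$ (an identity of analytic functions around $z=0$).
   Context: The pseudo-factorials $(\alpha_n)_{n\ge 0}$ are the integers defined by $\alpha_0=1$ and $\alpha_{n+1}=(-1)^{n+1}\sum_{k=0}^n\binom{n}{k}\alpha_k\alpha_{n-k}$ for $n\ge 0$. Since $|\alpha_n|\le n!$, the series $f(z)=\sum_{n\ge 0}\alpha_n z^n/n!$ is analytic at least in $|z|<1$. The Weierstrass function $\wp(z;g_2,g_3)$ is the elliptic function determined by $\wp'(z)^2=4\wp(z)^3-g_2\wp(z)-g_3$ and $\wp(z)\sim z^{-2}$ as $z\to 0$; thus here $\wp'(z)^2=4\wp(z)^3+4$. The constant is $\pi_3=3\int_0^1\frac{dy}{(1-y^3)^{2/3}}=\frac{\sqrt3}{2\pi}\Gamma(1/3)^3$. *)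

theory Defs
  imports "HOL-Complex_Analysis.Complex_Analysis"
begin

context
  notes sum.cong [fundef_cong]
begin

fun pseudo_factorial :: "nat \<Rightarrow> int" where
  "pseudo_factorial 0 = 1"
| "pseudo_factorial (Suc n) =
     (-1) ^ (n + 1) *
     (\<Sum>k = 0..n. int (n choose k) * pseudo_factorial k * pseudo_factorial (n - k))"

end

definition pseudo_factorial_egf :: "complex \<Rightarrow> complex" where
  "pseudo_factorial_egf z = (\<Sum>n. of_int (pseudo_factorial n) * z ^ n / fact n)"

(* "Nicely meromorphic" means meromorphic, continuous off the poles, and with value 0 at each
   pole, so that an elliptic function has no removable singularities or arbitrary values at its
   poles. The condition on Im says that the two periods are linearly independent over the reals. *)
definition elliptic_function :: "(complex \<Rightarrow> complex) \<Rightarrow> bool" where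
  "elliptic_function f \<longleftrightarrow>
     f nicely_meromorphic_on UNIV \<and>
     (\<exists>\<omega>1 \<omega>2. \<omega>1 \<noteq> 0 \<and> Im (\<omega>2 / \<omega>1) \<noteq> 0 \<and>
        (\<forall>z. f (z + \<omega>1) = f z) \<and> (\<forall>z. f (z + \<omega>2) = f z))"

(* Only meaningful when g2 ^ 3 is different from 27 * g3 ^ 2; otherwise no elliptic function
   satisfies the description. *)
definition weierstrass_p :: "complex \<Rightarrow> complex \<Rightarrow> complex \<Rightarrow> complex" where
  "weierstrass_p g2 g3 =
     (THE P. elliptic_function P \<and>
        (\<forall>z. \<not> is_pole P z \<longrightarrow> (deriv P z)\<^sup>2 = 4 * P z ^ 3 - g2 * P z - g3) \<and>
        P \<sim>[at 0] (\<lambda>z. 1 / z\<^sup>2))"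

definition smallest_positive_real_period :: "(complex \<Rightarrow> complex) \<Rightarrow> real \<Rightarrow> bool" where
  "smallest_positive_real_period f p \<longleftrightarrow>
     p > 0 \<and> (\<forall>z. f (z + of_real p) = f z) \<and>
     (\<forall>q::real. q > 0 \<and> (\<forall>z. f (z + of_real q) = f z) \<longrightarrow> p \<le> q)"

definition pi3 :: real where
  "pi3 = 3 * integral {0..1} (\<lambda>y. 1 / (1 - y ^ 3) powr (2 / 3))"

end

theory Submission imports Defs "HOL-Real_Asymp.Real_Asymp"
begin

text \<open>
Write \<open>f\<close> for the exponential generating function and put \<open>c = \<i> sqrt 3\<close>. The recursion says that
  \<open>f'(z) = -f(-z)^2\<close>. Hence \<open>f(z)^3 + f(-z)^3\<close> has derivative zero and equals 2, so that
  \<open>(f(z), f(-z))\<close> moves on a Fermat cubic. The classical change of variables from the Fermat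
  cubic to Weierstrass form suggests \<open>p(w) = -2 / (f(cw) + f(-cw))\<close>, and one checks
  \<open>p'^2 = 4 p^3 + 4\<close>, \<open>p(0) = -1\<close>, \<open>p'(0) = 0\<close> and \<open>f(cw) = (-p' - 2c) / (2cp)\<close>. So \<open>p\<close> should be
  the Weierstrass function in a coordinate centred at its real half period \<open>s = 3r\<close>; what remains
  is to construct that function, to show that it is the only candidate, and to compute \<open>s\<close>.

  The function is constructed without a lattice sum. The curve has complex multiplication by
  \<open>c\<close>, a square root of -3, which is expressed by \<open>p(cw) = -(p(w)^3 + 4) / (3 p(w)^2)\<close>
  (\<open>wp_seed_isogeny\<close>). As \<open>|c| > 1\<close>, this identity continues the germ \<open>p\<close> to larger
  and larger discs and so to the whole plane (\<open>meromorphic_extension_by_scaling\<close>).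

  All uniqueness statements rest on one observation. The difference \<open>D\<close> of two solutions of
  the differential equation satisfies a linear equation \<open>D' = E D\<close> where \<open>E\<close> has a simple pole
  with an integral residue \<open>L\<close>, so \<open>D\<close> is zero or of exact order \<open>L\<close>. Here \<open>L = 1\<close> at a half
  period and \<open>L = -3\<close> at a pole, and in both cases the initial conditions force a higher order
  (\<open>wp_ode_unique_half_period\<close>, \<open>wp_ode_unique_pole\<close>). The first case gives the complex
  multiplication; the second identifies the Weierstrass function \<open>P\<close> and yields its symmetries
  \<open>P(-z) = P(z)\<close> and \<open>P(wz) = w P(z)\<close> for a primitive cube root of unity \<open>w\<close>. These symmetries
  turn one period into two independent ones.

  On the real line \<open>p\<close> increases from -1 at 0 to its first pole at \<open>s\<close>, and the time that this
  takes is an elliptic integral (\<open>wp_shifted_first_pole\<close>). The substitution that makes the cube of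
  the value the new variable turns the parts below and above 0 into the Beta values
  \<open>B(1/3, 1/2) / 6\<close> and \<open>B(1/3, 1/6) / 6\<close>; the reflection and duplication formulas of the Gamma
  function reduce both to \<open>B(1/3, 1/3) = pi3\<close>. Since \<open>p\<close> is even and \<open>P(z) = p(z + s)\<close> is even,
  \<open>2s = 6r\<close> is a period, and it is the smallest one because \<open>p\<close> has no pole strictly between
  \<open>-s\<close> and \<open>s\<close>.
\<close>

section \<open>The generating function of the pseudo-factorials\<close>

text \<open>
  In the recursion, \<open>(n choose k)\<close> times the bounds \<open>k!\<close> and \<open>(n - k)!\<close> is \<open>n!\<close> for each of the \<open>n + 1\<close> summands.
\<close>
lemma abs_pseudo_factorial_le: "\<bar>pseudo_factorial n\<bar> \<le> fact n"
proof (induction n rule: less_induct)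
  case (less n)
  show ?case
  proof (cases n)
    case (Suc m)
    have "\<bar>pseudo_factorial n\<bar> =
        \<bar>\<Sum>k = 0..m. int (m choose k) * pseudo_factorial k * pseudo_factorial (m - k)\<bar>"
      by (simp add: Suc abs_mult)
    also have "\<dots> \<le> (\<Sum>k = 0..m. \<bar>int (m choose k) * pseudo_factorial k * pseudo_factorial (m - k)\<bar>)"
      by (rule sum_abs)
    also have "\<dots> \<le> (\<Sum>k = 0..m. fact m)"
    proof (rule sum_mono)
      fix k assume k: "k \<in> {0..m}"
      have "\<bar>int (m choose k) * pseudo_factorial k * pseudo_factorial (m - k)\<bar>
          = int (m choose k) * (\<bar>pseudo_factorial k\<bar> * \<bar>pseudo_factorial (m - k)\<bar>)"
        by (simp add: abs_mult)
      also have "\<dots> \<le> int (m choose k) * (fact k * fact (m - k))"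
        by (intro mult_left_mono mult_mono less) (use k Suc in auto)
      also have "\<dots> = int (fact k * fact (m - k) * (m choose k))"
        by simp
      also have "fact k * fact (m - k) * (m choose k) = (fact m :: nat)"
        by (rule binomial_fact_lemma) (use k in auto)
      finally show "\<bar>int (m choose k) * pseudo_factorial k * pseudo_factorial (m - k)\<bar> \<le> fact m"
        by simp
    qed
    also have "\<dots> = fact n"
      by (simp add: Suc algebra_simps)
    finally show ?thesis .
  qed simp
qed

definition pseudo_factorial_fps :: "complex fps" where
  "pseudo_factorial_fps = Abs_fps (\<lambda>n. of_int (pseudo_factorial n) / fact n)"

lemma pseudo_factorial_egf_eq_eval_fps: "pseudo_factorial_egf = eval_fps pseudo_factorial_fps"
  by (simp add: fun_eq_iff pseudo_factorial_egf_def eval_fps_def pseudo_factorial_fps_def)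

lemma conv_radius_geI_norm_le_1:
  fixes a :: "nat \<Rightarrow> complex"
  assumes "\<And>n. norm (a n) \<le> 1"
  shows "conv_radius a \<ge> 1"
proof (rule ccontr)
  assume "\<not> conv_radius a \<ge> 1"
  hence "conv_radius a < 1" by (simp only: not_le)
  then obtain r where r: "conv_radius a < ereal r" "ereal r < 1"
    using ereal_dense2 by blast
  have "0 < ereal r"
    by (rule le_less_trans[OF conv_radius_nonneg r(1)])
  hence "0 < r" by (simp only: ereal_less)
  moreover have "r < 1" using r(2) by (simp only: ereal_less)
  moreover have "norm (a n * of_real r ^ n) \<le> r ^ n" for n
    using mult_right_mono[OF assms[of n], of "r ^ n"] \<open>0 < r\<close>
    by (simp add: norm_mult norm_power)
  ultimately have "summable (\<lambda>n. a n * of_real r ^ n)"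
    by (intro summable_comparison_test'[OF summable_geometric, where N = 0]) auto
  from conv_radius_geI[OF this] r(1) \<open>r > 0\<close> show False
    by (simp add: not_le)
qed

lemma fps_conv_radius_pseudo_factorial: "fps_conv_radius pseudo_factorial_fps \<ge> 1"
  unfolding fps_conv_radius_def
proof (rule conv_radius_geI_norm_le_1)
  fix n
  have "real_of_int \<bar>pseudo_factorial n\<bar> \<le> real_of_int (fact n)"
    by (simp only: of_int_le_iff abs_pseudo_factorial_le)
  hence "\<bar>real_of_int (pseudo_factorial n)\<bar> \<le> fact n"
    by simp
  moreover have "norm (fps_nth pseudo_factorial_fps n) = \<bar>real_of_int (pseudo_factorial n)\<bar> / fact n"
    by (simp only: pseudo_factorial_fps_def fps_nth_Abs_fps norm_divide norm_of_int norm_fact)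
  ultimately show "norm (fps_nth pseudo_factorial_fps n) \<le> 1"
    by (simp only: divide_le_eq_1_pos fact_gt_zero)
qed

lemma less_fps_conv_radius_pseudo_factorial:
  "norm z < 1 \<Longrightarrow> ereal (norm z) < fps_conv_radius pseudo_factorial_fps"
  by (rule less_le_trans[OF _ fps_conv_radius_pseudo_factorial]) simp

lemma pseudo_factorial_egf_0 [simp]: "pseudo_factorial_egf 0 = 1"
  by (simp add: pseudo_factorial_egf_eq_eval_fps eval_fps_at_0 pseudo_factorial_fps_def)

text \<open>
  The sum in the recursion is the binomial convolution that multiplies exponential generating
  functions; the sign \<open>(-1)^(n + 1)\<close> replaces the argument by its negative.
\<close>
lemma has_field_derivative_pseudo_factorial_egf:
  assumes "norm z < 1"
  shows "(pseudo_factorial_egf has_field_derivative -(pseudo_factorial_egf (-z))\<^sup>2) (at z)"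
proof -
  define G where "G = Abs_fps (\<lambda>n. (-1) ^ n * (fps_nth pseudo_factorial_fps n))"
  have G: "fps_conv_radius G \<ge> 1"
    unfolding fps_conv_radius_def G_def using fps_conv_radius_pseudo_factorial
    by (subst conv_radius_cong[where g = "fps_nth pseudo_factorial_fps"])
       (auto simp: norm_mult norm_power fps_conv_radius_def)
  have "fps_deriv pseudo_factorial_fps = -(G * G)"
  proof (rule fps_ext)
    fix n
    have *: "of_nat (n choose k) / fact n = (1 / (fact k * fact (n - k)) :: complex)"
      if "k \<in> {0..n}" for k
      using that by (subst binomial_fact) auto
    have "fps_nth (fps_deriv pseudo_factorial_fps) n = of_int (pseudo_factorial (Suc n)) / fact n"
      by (simp add: pseudo_factorial_fps_def divide_simps del: of_nat_Suc pseudo_factorial.simps)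
    also have "\<dots> = (-1) ^ (n + 1) * (\<Sum>k = 0..n. (of_nat (n choose k) / fact n) * of_int (pseudo_factorial k) *
        of_int (pseudo_factorial (n - k)))"
      by (simp add: sum_divide_distrib[symmetric] mult_ac)
    also have "\<dots> = (-1) ^ (n + 1) * (\<Sum>k = 0..n. (1 / (fact k * fact (n - k))) * of_int (pseudo_factorial k) *
        of_int (pseudo_factorial (n - k)))"
      by (intro arg_cong2[where f = "(*)"] sum.cong) (use * in auto)
    also have "\<dots> = (\<Sum>k = 0..n. - (fps_nth G k * fps_nth G (n - k)))"
      unfolding sum_distrib_left
    proof (rule sum.cong)
      fix k assume "k \<in> {0..n}"
      hence "(-1::complex) ^ n = (-1) ^ k * (-1) ^ (n - k)"
        by (simp flip: power_add)
      thus "(-1) ^ (n + 1) * (1 / (fact k * fact (n - k)) * of_int (pseudo_factorial k) *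
        of_int (pseudo_factorial (n - k))) = - (fps_nth G k * fps_nth G (n - k))"
        by (simp add: G_def pseudo_factorial_fps_def)
    qed simp
    also have "\<dots> = fps_nth (-(G * G)) n"
      by (simp add: fps_mult_nth sum_negf)
    finally show "fps_nth (fps_deriv pseudo_factorial_fps) n = fps_nth (-(G * G)) n" .
  qed
  moreover have "eval_fps G z = pseudo_factorial_egf (-z)"
    by (simp add: pseudo_factorial_egf_eq_eval_fps eval_fps_def G_def power_minus[of z] mult_ac)
  moreover have "ereal (norm z) < fps_conv_radius G"
    using assms G by (intro less_le_trans[OF _ G]) simp
  ultimately have "eval_fps (fps_deriv pseudo_factorial_fps) z = -(pseudo_factorial_egf (-z))\<^sup>2"
    by (simp add: eval_fps_minus eval_fps_mult power2_eq_square less_le_trans[OF _ fps_conv_radius_mult])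
  thus ?thesis
    using has_field_derivative_eval_fps[OF less_fps_conv_radius_pseudo_factorial[OF assms], of UNIV]
    by (simp add: pseudo_factorial_egf_eq_eval_fps)
qed

text \<open>
  The derivative of the left-hand side is \<open>-3 f(z)^2 f(-z)^2 + 3 f(-z)^2 f(z)^2 = 0\<close>.
\<close>
lemma pseudo_factorial_egf_fermat:
  assumes "norm z < 1"
  shows "pseudo_factorial_egf z ^ 3 + pseudo_factorial_egf (-z) ^ 3 = 2"
proof -
  let ?h = "\<lambda>z. pseudo_factorial_egf z ^ 3 + pseudo_factorial_egf (-z) ^ 3"
  have "(?h has_field_derivative 0) (at w within ball 0 1)" if "w \<in> ball 0 1" for w
  proof -
    let ?f = "pseudo_factorial_egf w" and ?g = "pseudo_factorial_egf (-w)"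
    have f: "(pseudo_factorial_egf has_field_derivative - ?g\<^sup>2) (at w)"
      using has_field_derivative_pseudo_factorial_egf[of w] that by simp
    have g: "((\<lambda>w. pseudo_factorial_egf (-w)) has_field_derivative - ?f\<^sup>2 * -1) (at w)"
      using has_field_derivative_pseudo_factorial_egf[of "-w"] that
      by (intro DERIV_chain2[where g = uminus]) (auto intro!: derivative_eq_intros)
    have "(?h has_field_derivative
        3 * (- ?g\<^sup>2 * ?f ^ 2) + 3 * ((- ?f\<^sup>2 * -1) * ?g ^ 2)) (at w)"
      using DERIV_add[OF DERIV_power[OF f, of 3] DERIV_power[OF g, of 3]] by simp
    thus ?thesis
      by (simp add: has_field_derivative_at_within)
  qed
  from has_field_derivative_zero_constant[OF convex_ball this]
  obtain k where "\<And>w. w \<in> ball 0 1 \<Longrightarrow> ?h w = k" by blast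
  from this[of z] this[of 0] assms show ?thesis by simp
qed

lemma pseudo_factorial_egf_cnj:
  assumes "norm z < 1"
  shows "pseudo_factorial_egf (cnj z) = cnj (pseudo_factorial_egf z)"
proof -
  have "(\<lambda>n. fps_nth pseudo_factorial_fps n * z ^ n) sums pseudo_factorial_egf z"
    unfolding pseudo_factorial_egf_eq_eval_fps
    by (rule sums_eval_fps[OF less_fps_conv_radius_pseudo_factorial[OF assms]])
  hence "(\<lambda>n. cnj (fps_nth pseudo_factorial_fps n * z ^ n)) sums cnj (pseudo_factorial_egf z)"
    by (simp only: sums_cnj)
  hence "(\<lambda>n. fps_nth pseudo_factorial_fps n * cnj z ^ n) sums cnj (pseudo_factorial_egf z)"
    by (simp add: pseudo_factorial_fps_def)
  thus ?thesis
    by (simp add: pseudo_factorial_egf_eq_eval_fps eval_fps_def sums_iff)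
qed

section \<open>Uniqueness for the Weierstrass equation\<close>

lemma eventually_nhds_imp_at: "eventually P (nhds z) \<Longrightarrow> eventually P (at z)"
  by (simp add: eventually_at_filter eventually_mono)

text \<open>
  The logarithmic derivative of \<open>H(z) z^n\<close> is \<open>n/z + H'(z)/H(z)\<close>, and the second summand stays bounded.
\<close>
lemma tendsto_log_deriv:
  assumes f: "\<And>z. z \<in> ball 0 r - {0} \<Longrightarrow> f z = H z * z powi n"
    and H: "H holomorphic_on ball 0 r" "H 0 \<noteq> 0" and r: "r > 0"
  shows "(\<lambda>z. z * deriv f z / f z) \<midarrow>0\<rightarrow> complex_of_int n"
proof -
  have H_an: "H analytic_on {0}"
    using H(1) r by (meson analytic_at centre_in_ball open_ball)
  hence H_cont: "isCont H 0" and H'_cont: "isCont (deriv H) 0"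
    by (simp_all add: analytic_at_imp_isCont analytic_deriv)
  have "(\<lambda>z. z * deriv H z / H z + of_int n) \<midarrow>0\<rightarrow> 0 * deriv H 0 / H 0 + of_int n"
    using H(2) H_cont H'_cont by (intro tendsto_intros isContD) auto
  also have "?this \<longleftrightarrow> ?thesis"
  proof (rule tendsto_cong[THEN trans])
    have "eventually (\<lambda>z. z \<in> ball 0 r - {0}) (at (0::complex))"
      using r by (intro eventually_at_in_open) auto
    moreover have "eventually (\<lambda>z. H z \<noteq> 0) (at 0)"
      using H_cont H(2) by (intro tendsto_imp_eventually_ne) (auto dest: isContD)
    ultimately show "eventually (\<lambda>z. z * deriv H z / H z + of_int n = z * deriv f z / f z) (at 0)"
    proof eventually_elim
      case (elim z)
      have "deriv f z = deriv (\<lambda>z. H z * z powi n) z"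
      proof (rule deriv_cong_ev)
        show "eventually (\<lambda>z. f z = H z * z powi n) (nhds z)"
          using eventually_nhds_in_open[OF open_delete[OF open_ball] elim(1)]
          by eventually_elim (use f in auto)
      qed simp
      also have "\<dots> = deriv H z * z powi n + of_int n * z powi (n - 1) * H z"
      proof (rule DERIV_imp_deriv)
        have "(H has_field_derivative deriv H z) (at z)"
          using H(1) elim by (intro holomorphic_derivI[of _ "ball 0 r"]) auto
        thus "((\<lambda>z. H z * z powi n) has_field_derivative
            deriv H z * z powi n + of_int n * z powi (n - 1) * H z) (at z)"
          using elim by (auto intro!: derivative_eq_intros)
      qed
      finally have "z * deriv f z = (z * deriv H z + of_int n * H z) * z powi n"
        using elim by (simp add: power_int_diff algebra_simps)
      moreover have "f z = H z * z powi n"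
        using elim f by auto
      ultimately show ?case
        using elim by (simp add: field_simps)
    qed
  qed simp
  finally show ?thesis .
qed

lemma tendsto_log_deriv':
  assumes mero: "f meromorphic_on {0}" and lim: "(\<lambda>z. f z / z powi n) \<midarrow>0\<rightarrow> c" and c: "c \<noteq> 0"
  shows "(\<lambda>z. z * deriv f z / f z) \<midarrow>0\<rightarrow> complex_of_int n"
proof -
  define H where "H z = (if z = 0 then c else f z / z powi n)" for z
  have ev: "eventually (\<lambda>z. H z = f z / z powi n) (at 0)"
    unfolding eventually_at_filter by (simp add: H_def)
  have "(\<lambda>z. f z / z powi n) meromorphic_on {0}"
    by (intro meromorphic_intros mero)
  hence "H meromorphic_on {0}"
    using meromorphic_on_cong[of "{0}" H "\<lambda>z. f z / z powi n" "{0}"] ev by simp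
  moreover have "isCont H 0"
    unfolding isCont_def using lim iffD2[OF tendsto_cong[OF ev]] by (simp add: H_def[of 0])
  ultimately have "H analytic_on {0}"
    by (rule meromorphic_at_isCont_imp_analytic)
  then obtain r where r: "r > 0" "H holomorphic_on ball 0 r"
    by (auto simp: analytic_on_def)
  show ?thesis
    by (rule tendsto_log_deriv[OF _ r(2) _ r(1)]) (use c in \<open>auto simp: H_def\<close>)
qed

text \<open>
  The equation fixes the order of a nonzero \<open>D\<close> at 0: it is the limit of \<open>z D'/D\<close>, hence \<open>L\<close>.
  The last assumption says that the order is larger.
\<close>
lemma meromorphic_regular_singular_unique:
  assumes mero: "D meromorphic_on {0}"
    and ode: "eventually (\<lambda>z. deriv D z = E z * D z) (at 0)"
    and E: "(\<lambda>z. z * E z) \<midarrow>0\<rightarrow> of_int L"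
    and D: "(\<lambda>z. D z / z powi L) \<midarrow>0\<rightarrow> 0"
  shows "eventually (\<lambda>z. D z = 0) (at 0)"
proof (rule ccontr)
  assume "\<not> eventually (\<lambda>z. D z = 0) (at 0)"
  hence "frequently (\<lambda>z. D z \<noteq> 0) (at 0)"
    by (simp add: frequently_def)
  moreover have "isolated_singularity_at D 0" "not_essential D 0"
    using mero by (simp_all add: meromorphic_at_iff)
  ultimately obtain n g r where g: "g 0 \<noteq> 0" "r > 0" "g holomorphic_on cball 0 r"
      "\<And>w. w \<in> cball 0 r - {0} \<Longrightarrow> D w = g w * w powi n \<and> g w \<noteq> 0"
    using zorder_exist[of D 0] by auto
  have g': "g holomorphic_on ball 0 r"
    using g(3) ball_subset_cball holomorphic_on_subset by blast
  have D_eq: "D z = g z * z powi n \<and> g z \<noteq> 0" if "norm z < r" "z \<noteq> 0" for z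
    using g(4)[of z] that by simp
  have in_ball: "eventually (\<lambda>z. z \<in> ball 0 r - {0}) (at (0::complex))"
    using g(2) by (intro eventually_at_in_open) auto
  have "(\<lambda>z. z * deriv D z / D z) \<midarrow>0\<rightarrow> complex_of_int n"
  proof (rule tendsto_log_deriv[OF _ g' g(1,2)])
    fix z :: complex assume "z \<in> ball 0 r - {0}"
    thus "D z = g z * z powi n"
      using D_eq by simp
  qed
  moreover have "eventually (\<lambda>z. z * deriv D z / D z = z * E z) (at 0)"
    using ode in_ball
  proof eventually_elim
    case (elim z)
    hence "D z \<noteq> 0"
      using D_eq[of z] by simp
    thus ?case
      using elim(1) by simp
  qed
  ultimately have "(\<lambda>z. z * E z) \<midarrow>0\<rightarrow> of_int n"
    by (rule Lim_transform_eventually)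
  from LIM_unique[OF this E] have "n = L"
    by simp
  have "eventually (\<lambda>z. D z / z powi L = g z) (at 0)"
    using in_ball
  proof eventually_elim
    case (elim z)
    thus ?case
      using D_eq[of z] \<open>n = L\<close> by simp
  qed
  from Lim_transform_eventually[OF D this] have "g \<midarrow>0\<rightarrow> 0" .
  moreover have "g \<midarrow>0\<rightarrow> g 0"
    using g' g(2) by (metis centre_in_ball continuous_on_interior holomorphic_on_imp_continuous_on
        interior_ball isContD)
  ultimately show False
    using g(1) LIM_unique by blast
qed

definition wp_ode :: "(complex \<Rightarrow> complex) \<Rightarrow> complex \<Rightarrow> bool" where
  "wp_ode P z \<longleftrightarrow> (deriv P z)\<^sup>2 = 4 * P z ^ 3 + 4"

text \<open>
  Subtracting the two equations and factoring both sides gives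
  \<open>(P' + Q') (P - Q)' = 4 (P^2 + P Q + Q^2) (P - Q)\<close>, which is linear in the difference.
\<close>
lemma wp_ode_unique_aux:
  assumes mero: "P meromorphic_on {0}" "Q meromorphic_on {0}"
    and ode: "eventually (wp_ode P) (at 0)" "eventually (wp_ode Q) (at 0)"
    and sum_nz: "eventually (\<lambda>z. deriv P z + deriv Q z \<noteq> 0) (at 0)"
    and E: "(\<lambda>z. z * (4 * ((P z)\<^sup>2 + P z * Q z + (Q z)\<^sup>2) / (deriv P z + deriv Q z))) \<midarrow>0\<rightarrow> of_int L"
    and D: "(\<lambda>z. (P z - Q z) / z powi L) \<midarrow>0\<rightarrow> 0"
  shows "eventually (\<lambda>z. P z = Q z) (at 0)"
proof -
  have "eventually (\<lambda>z. P analytic_on {z}) (at 0)" "eventually (\<lambda>z. Q analytic_on {z}) (at 0)"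
    using mero by (auto simp: meromorphic_at_iff isolated_singularity_at_altdef)
  hence "eventually (\<lambda>z. deriv (\<lambda>z. P z - Q z) z =
      4 * ((P z)\<^sup>2 + P z * Q z + (Q z)\<^sup>2) / (deriv P z + deriv Q z) * (P z - Q z)) (at 0)"
    using ode sum_nz
  proof eventually_elim
    case (elim z)
    have "deriv (\<lambda>z. P z - Q z) z = deriv P z - deriv Q z"
      using elim by (intro deriv_diff) (auto simp: analytic_on_imp_differentiable_at)
    moreover have "(deriv P z - deriv Q z) * (deriv P z + deriv Q z)
        = 4 * ((P z)\<^sup>2 + P z * Q z + (Q z)\<^sup>2) * (P z - Q z)"
      using elim(3,4) unfolding wp_ode_def by algebra
    ultimately show ?case
      using elim(5) by (simp add: eq_divide_eq)
  qed
  from meromorphic_regular_singular_unique[OF _ this E D]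
  have "eventually (\<lambda>z. P z - Q z = 0) (at 0)"
    using mero by (auto intro!: meromorphic_intros)
  thus ?thesis by simp
qed

text \<open>
  Near the pole \<open>P' + Q'\<close> behaves like \<open>-4 / z^3\<close> and \<open>4 (P^2 + P Q + Q^2)\<close> like \<open>12 / z^4\<close>. So a
  nonzero difference would have a pole of order 3, but the double poles cancel.
\<close>
lemma wp_ode_unique_pole:
  assumes mero: "P meromorphic_on {0}" "Q meromorphic_on {0}"
    and ode: "eventually (wp_ode P) (at 0)" "eventually (wp_ode Q) (at 0)"
    and pole: "(\<lambda>z. z\<^sup>2 * P z) \<midarrow>0\<rightarrow> 1" "(\<lambda>z. z\<^sup>2 * Q z) \<midarrow>0\<rightarrow> 1"
  shows "eventually (\<lambda>z. P z = Q z) (at 0)"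
proof -
  have nz: "eventually (\<lambda>z::complex. z \<noteq> 0) (at 0)"
    by (simp add: eventually_at_filter)
  have d: "(\<lambda>z. z ^ 3 * deriv F z) \<midarrow>0\<rightarrow> -2"
    if F: "F meromorphic_on {0}" "(\<lambda>z. z\<^sup>2 * F z) \<midarrow>0\<rightarrow> 1" for F
  proof -
    have "(\<lambda>z. F z / z powi (-2)) \<midarrow>0\<rightarrow> 1"
      using F(2) by (simp add: power_int_minus divide_inverse mult.commute)
    from tendsto_log_deriv'[OF F(1) this] have "(\<lambda>z. z * deriv F z / F z) \<midarrow>0\<rightarrow> -2"
      by simp
    from tendsto_mult[OF this F(2)]
    have "(\<lambda>z. z * deriv F z / F z * (z\<^sup>2 * F z)) \<midarrow>0\<rightarrow> -2" by simp
    moreover have "eventually (\<lambda>z. z\<^sup>2 * F z \<noteq> 0) (at 0)"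
      using F(2) by (intro tendsto_imp_eventually_ne) auto
    hence "eventually (\<lambda>z. z * deriv F z / F z * (z\<^sup>2 * F z) = z ^ 3 * deriv F z) (at 0)"
      by eventually_elim (simp add: power2_eq_square power3_eq_cube)
    ultimately show ?thesis
      by (rule Lim_transform_eventually)
  qed
  have sum: "(\<lambda>z. z ^ 3 * deriv P z + z ^ 3 * deriv Q z) \<midarrow>0\<rightarrow> -2 + -2"
    using d mero pole by (intro tendsto_add) auto
  hence ev: "eventually (\<lambda>z. z ^ 3 * deriv P z + z ^ 3 * deriv Q z \<noteq> 0) (at 0)"
    by (rule tendsto_imp_eventually_ne) auto
  show ?thesis
  proof (rule wp_ode_unique_aux[OF mero ode, where L = "-3"])
    show "eventually (\<lambda>z. deriv P z + deriv Q z \<noteq> 0) (at 0)"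
      using ev by eventually_elim (metis distrib_left mult_zero_right)
    have "(\<lambda>z. 4 * ((z\<^sup>2 * P z)\<^sup>2 + (z\<^sup>2 * P z) * (z\<^sup>2 * Q z) + (z\<^sup>2 * Q z)\<^sup>2) /
        (z ^ 3 * deriv P z + z ^ 3 * deriv Q z)) \<midarrow>0\<rightarrow> 4 * (1\<^sup>2 + 1 * 1 + 1\<^sup>2) / (-2 + -2)"
      by (intro tendsto_intros pole sum) auto
    moreover have "eventually (\<lambda>z. 4 * ((z\<^sup>2 * P z)\<^sup>2 + (z\<^sup>2 * P z) * (z\<^sup>2 * Q z) + (z\<^sup>2 * Q z)\<^sup>2) /
        (z ^ 3 * deriv P z + z ^ 3 * deriv Q z)
        = z * (4 * ((P z)\<^sup>2 + P z * Q z + (Q z)\<^sup>2) / (deriv P z + deriv Q z))) (at 0)"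
      using nz
    proof eventually_elim
      case (elim z)
      have "4 * ((z\<^sup>2 * P z)\<^sup>2 + (z\<^sup>2 * P z) * (z\<^sup>2 * Q z) + (z\<^sup>2 * Q z)\<^sup>2)
          = z ^ 3 * (z * (4 * ((P z)\<^sup>2 + P z * Q z + (Q z)\<^sup>2)))"
        by algebra
      moreover have "z ^ 3 * deriv P z + z ^ 3 * deriv Q z = z ^ 3 * (deriv P z + deriv Q z)"
        by algebra
      ultimately show ?case using elim by simp
    qed
    ultimately have "(\<lambda>z. z * (4 * ((P z)\<^sup>2 + P z * Q z + (Q z)\<^sup>2) / (deriv P z + deriv Q z)))
        \<midarrow>0\<rightarrow> 4 * (1\<^sup>2 + 1 * 1 + 1\<^sup>2) / (-2 + -2)"
      by (rule Lim_transform_eventually)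
    thus "(\<lambda>z. z * (4 * ((P z)\<^sup>2 + P z * Q z + (Q z)\<^sup>2) / (deriv P z + deriv Q z)))
        \<midarrow>0\<rightarrow> of_int (-3)"
      by simp
    have "(\<lambda>z. z * (z\<^sup>2 * P z - z\<^sup>2 * Q z)) \<midarrow>0\<rightarrow> 0 * (1 - 1)"
      by (intro tendsto_intros pole)
    moreover have "(\<lambda>z. z * (z\<^sup>2 * P z - z\<^sup>2 * Q z)) = (\<lambda>z. (P z - Q z) / z powi (-3))"
      by (simp add: fun_eq_iff power_int_minus divide_inverse algebra_simps power2_eq_square power3_eq_cube)
    ultimately show "(\<lambda>z. (P z - Q z) / z powi (-3)) \<midarrow>0\<rightarrow> 0"
      by simp
  qed
qed

text \<open>
  At a zero of the derivative the first-order equation alone does not determine the solution,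
  since the constant -1 solves it as well. Prescribing the second derivative 6 excludes the
  constant: now \<open>P' + Q'\<close> behaves like \<open>12 z\<close> and \<open>4 (P^2 + P Q + Q^2)\<close> tends to 12, so that a
  nonzero difference would have a simple zero, contradicting \<open>P'(0) = Q'(0) = 0\<close>.
\<close>
lemma wp_ode_unique_half_period:
  assumes an: "P analytic_on {0}" "Q analytic_on {0}"
    and ode: "eventually (wp_ode P) (at 0)" "eventually (wp_ode Q) (at 0)"
    and init: "P 0 = -1" "Q 0 = -1"
    and deriv: "(\<lambda>z. deriv P z / z) \<midarrow>0\<rightarrow> 6" "(\<lambda>z. deriv Q z / z) \<midarrow>0\<rightarrow> 6"
  shows "eventually (\<lambda>z. P z = Q z) (at 0)"
proof -
  have nz: "eventually (\<lambda>z::complex. z \<noteq> 0) (at 0)"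
    by (simp add: eventually_at_filter)
  have lims: "P \<midarrow>0\<rightarrow> -1" "Q \<midarrow>0\<rightarrow> -1"
    using an init analytic_at_imp_isCont isContD by metis+
  have d: "(\<lambda>z. (F z + 1) / z) \<midarrow>0\<rightarrow> 0"
    if F: "F analytic_on {0}" "F 0 = -1" "(\<lambda>z. deriv F z / z) \<midarrow>0\<rightarrow> 6" for F
  proof -
    have "(\<lambda>z. z * (deriv F z / z)) \<midarrow>0\<rightarrow> 0 * 6"
      by (intro tendsto_intros F)
    moreover have "eventually (\<lambda>z. z * (deriv F z / z) = deriv F z) (at 0)"
      using nz by eventually_elim simp
    ultimately have "deriv F \<midarrow>0\<rightarrow> 0 * 6"
      by (rule Lim_transform_eventually)
    hence "deriv F \<midarrow>0\<rightarrow> 0" by simp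
    moreover have "deriv F \<midarrow>0\<rightarrow> deriv F 0"
      using F(1) by (intro isContD analytic_at_imp_isCont analytic_deriv)
    ultimately have "deriv F 0 = 0"
      using LIM_unique by blast
    hence "(F has_field_derivative 0) (at 0)"
      using F(1) by (metis DERIV_deriv_iff_field_differentiable analytic_on_imp_differentiable_at singletonI)
    thus ?thesis
      using F(2) by (simp add: DERIV_def)
  qed
  have sum: "(\<lambda>z. deriv P z / z + deriv Q z / z) \<midarrow>0\<rightarrow> 6 + 6"
    by (intro tendsto_add deriv)
  hence ev: "eventually (\<lambda>z. deriv P z / z + deriv Q z / z \<noteq> 0) (at 0)"
    by (rule tendsto_imp_eventually_ne) auto
  show ?thesis
  proof (rule wp_ode_unique_aux[OF _ _ ode, where L = 1])
    show "P meromorphic_on {0}" "Q meromorphic_on {0}"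
      using an by (auto intro: analytic_on_imp_meromorphic_on)
    show "eventually (\<lambda>z. deriv P z + deriv Q z \<noteq> 0) (at 0)"
      using ev by eventually_elim (metis add_divide_distrib div_0)
    have "(\<lambda>z. 4 * ((P z)\<^sup>2 + P z * Q z + (Q z)\<^sup>2) / (deriv P z / z + deriv Q z / z))
        \<midarrow>0\<rightarrow> 4 * ((-1)\<^sup>2 + (-1) * (-1) + (-1)\<^sup>2) / (6 + 6)"
      by (intro tendsto_intros lims sum) auto
    moreover have "eventually (\<lambda>z. 4 * ((P z)\<^sup>2 + P z * Q z + (Q z)\<^sup>2) / (deriv P z / z + deriv Q z / z)
        = z * (4 * ((P z)\<^sup>2 + P z * Q z + (Q z)\<^sup>2) / (deriv P z + deriv Q z))) (at 0)"
      using nz by eventually_elim (simp only: add_divide_distrib[symmetric] divide_divide_eq_right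
          times_divide_eq_right mult.commute)
    ultimately have "(\<lambda>z. z * (4 * ((P z)\<^sup>2 + P z * Q z + (Q z)\<^sup>2) / (deriv P z + deriv Q z)))
        \<midarrow>0\<rightarrow> 4 * ((-1)\<^sup>2 + (-1) * (-1) + (-1)\<^sup>2) / (6 + 6)"
      by (rule Lim_transform_eventually)
    thus "(\<lambda>z. z * (4 * ((P z)\<^sup>2 + P z * Q z + (Q z)\<^sup>2) / (deriv P z + deriv Q z)))
        \<midarrow>0\<rightarrow> of_int 1"
      by simp
    have "(\<lambda>z. (P z + 1) / z - (Q z + 1) / z) \<midarrow>0\<rightarrow> 0 - 0"
      by (intro tendsto_diff d an init deriv)
    moreover have "(\<lambda>z. (P z + 1) / z - (Q z + 1) / z) = (\<lambda>z. (P z - Q z) / z powi 1)"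
      by (simp add: fun_eq_iff diff_divide_distrib[symmetric])
    ultimately show "(\<lambda>z. (P z - Q z) / z powi 1) \<midarrow>0\<rightarrow> 0"
      by simp
  qed
qed

section \<open>The Weierstrass solution hidden in the generating function\<close>

definition isqrt3 :: complex where
  "isqrt3 = \<i> * of_real (sqrt 3)"

lemma isqrt3_power2 [simp]: "isqrt3\<^sup>2 = -3"
  by (simp add: isqrt3_def power_mult_distrib flip: of_real_power)

lemma isqrt3_nonzero [simp]: "isqrt3 \<noteq> 0"
  by (simp add: isqrt3_def)

lemma norm_isqrt3: "norm isqrt3 = sqrt 3"
  by (simp add: isqrt3_def norm_mult)

lemma cnj_isqrt3 [simp]: "cnj isqrt3 = -isqrt3"
  by (simp add: isqrt3_def)

text \<open>
  The germ at a real half period of the Weierstrass function: the point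
  \<open>(f(cw), f(-cw))\<close> of the Fermat cubic, in the \<open>x\<close>-coordinate of the Weierstrass form.
\<close>
definition wp_seed :: "complex \<Rightarrow> complex" where
  "wp_seed w = -2 / (pseudo_factorial_egf (isqrt3 * w) + pseudo_factorial_egf (-(isqrt3 * w)))"

lemma wp_seed_minus: "wp_seed (-w) = wp_seed w"
  by (simp add: wp_seed_def add.commute)

lemma wp_seed_0: "wp_seed 0 = -1"
  by (simp add: wp_seed_def)

lemma wp_seed_cnj:
  assumes "norm (isqrt3 * w) < 1"
  shows "wp_seed (cnj w) = cnj (wp_seed w)"
proof -
  have eq: "isqrt3 * cnj w = cnj (-(isqrt3 * w))"
    by simp
  have "pseudo_factorial_egf (isqrt3 * cnj w) = cnj (pseudo_factorial_egf (-(isqrt3 * w)))"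
       "pseudo_factorial_egf (-(isqrt3 * cnj w)) = cnj (pseudo_factorial_egf (isqrt3 * w))"
    unfolding eq using pseudo_factorial_egf_cnj[of "-(isqrt3 * w)"] pseudo_factorial_egf_cnj[of "isqrt3 * w"]
      assms by simp_all
  thus ?thesis
    unfolding wp_seed_def by (simp add: add.commute)
qed

lemma wp_seed_has_field_derivative:
  assumes "norm (isqrt3 * w) < 1"
  defines "a \<equiv> pseudo_factorial_egf (isqrt3 * w)" and "b \<equiv> pseudo_factorial_egf (-(isqrt3 * w))"
  assumes nz: "a + b \<noteq> 0"
  shows "(wp_seed has_field_derivative 2 * isqrt3 * (a - b) / (a + b)) (at w)"
proof -
  have a: "((\<lambda>w. pseudo_factorial_egf (isqrt3 * w)) has_field_derivative - b\<^sup>2 * isqrt3) (at w)"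
    unfolding b_def
    by (rule DERIV_chain2[where g = "\<lambda>w. isqrt3 * w", OF has_field_derivative_pseudo_factorial_egf[OF assms(1)]])
       (auto intro!: derivative_eq_intros)
  have b: "((\<lambda>w. pseudo_factorial_egf (-(isqrt3 * w))) has_field_derivative - a\<^sup>2 * -isqrt3) (at w)"
    using has_field_derivative_pseudo_factorial_egf[of "-(isqrt3 * w)"] assms(1)
    unfolding a_def by (intro DERIV_chain2[where g = "\<lambda>w. -(isqrt3 * w)"])
       (auto intro!: derivative_eq_intros)
  have "(wp_seed has_field_derivative
      - ((-2) * (- b\<^sup>2 * isqrt3 + (- a\<^sup>2 * -isqrt3))) / ((a + b) * (a + b))) (at w)"
    unfolding wp_seed_def [abs_def]
    using DERIV_divide[OF DERIV_const[of "-2"] DERIV_add[OF a b]] nz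
    by (simp add: a_def b_def)
  moreover have "- ((-2) * (- b\<^sup>2 * isqrt3 + (- a\<^sup>2 * -isqrt3))) / ((a + b) * (a + b))
      = 2 * isqrt3 * (a - b) / (a + b)"
  proof -
    have "- ((-2) * (- b\<^sup>2 * isqrt3 + (- a\<^sup>2 * -isqrt3))) = (2 * isqrt3 * (a - b)) * (a + b)"
      by (simp add: algebra_simps power2_eq_square)
    thus ?thesis using nz by simp
  qed
  ultimately show ?thesis by simp
qed

text \<open>
  With \<open>a = f(cw)\<close> and \<open>b = f(-cw)\<close> this is the identity
  \<open>(a + b)^3 - 4 (a^3 + b^3) = -3 (a - b)^2 (a + b)\<close> together with \<open>a^3 + b^3 = 2\<close>.
\<close>
lemma wp_seed_ode:
  assumes "norm (isqrt3 * w) < 1"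
    and nz: "pseudo_factorial_egf (isqrt3 * w) + pseudo_factorial_egf (-(isqrt3 * w)) \<noteq> 0"
  shows "wp_ode wp_seed w"
proof -
  define a b where "a = pseudo_factorial_egf (isqrt3 * w)" and "b = pseudo_factorial_egf (-(isqrt3 * w))"
  have nz': "a + b \<noteq> 0"
    using nz by (simp add: a_def b_def)
  have fermat: "a ^ 3 + b ^ 3 = 2"
    unfolding a_def b_def by (rule pseudo_factorial_egf_fermat) fact
  have "(deriv wp_seed w)\<^sup>2 = (isqrt3\<^sup>2 * (4 * (a - b)\<^sup>2)) / (a + b)\<^sup>2"
    using DERIV_imp_deriv[OF wp_seed_has_field_derivative[OF assms]]
    by (simp add: a_def b_def power_divide power_mult_distrib)
  also have "\<dots> = (-12 * (a - b)\<^sup>2 * (a + b)) / (a + b) ^ 3"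
    unfolding isqrt3_power2 using nz' by (simp add: power2_eq_square power3_eq_cube)
  also have "-12 * (a - b)\<^sup>2 * (a + b) = 4 * (-8) + 4 * (a + b) ^ 3"
  proof -
    have "(a + b) ^ 3 - 4 * (a ^ 3 + b ^ 3) = -3 * (a - b)\<^sup>2 * (a + b)"
      by (simp add: power2_eq_square power3_eq_cube algebra_simps)
    thus ?thesis
      unfolding fermat by algebra
  qed
  also have "(4 * (-8) + 4 * (a + b) ^ 3) / (a + b) ^ 3 = 4 * ((-2) ^ 3 / (a + b) ^ 3) + 4"
    using nz' by (simp add: field_simps)
  also have "\<dots> = 4 * wp_seed w ^ 3 + 4"
    by (simp add: wp_seed_def a_def b_def power_divide)
  finally show ?thesis
    by (simp add: wp_ode_def)
qed

text \<open>
  The value of \<open>wp_seed\<close> gives the sum of \<open>f(cw)\<close> and \<open>f(-cw)\<close>, and its logarithmic derivative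
  gives their difference; solving for \<open>f(cw)\<close> inverts the change of variables.
\<close>
lemma pseudo_factorial_egf_eq_wp_seed:
  assumes "norm (isqrt3 * w) < 1"
    and nz: "pseudo_factorial_egf (isqrt3 * w) + pseudo_factorial_egf (-(isqrt3 * w)) \<noteq> 0"
  shows "pseudo_factorial_egf (isqrt3 * w) =
           (- deriv wp_seed w - 2 * isqrt3) / (2 * isqrt3 * wp_seed w)"
proof -
  define a b where "a = pseudo_factorial_egf (isqrt3 * w)" and "b = pseudo_factorial_egf (-(isqrt3 * w))"
  have nz': "a + b \<noteq> 0"
    using nz by (simp add: a_def b_def)
  have "deriv wp_seed w = 2 * isqrt3 * (a - b) / (a + b)"
    using DERIV_imp_deriv[OF wp_seed_has_field_derivative[OF assms]] by (simp add: a_def b_def)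
  moreover have "wp_seed w = -2 / (a + b)"
    by (simp add: wp_seed_def a_def b_def)
  moreover have "a = (- (2 * isqrt3 * (a - b) / (a + b)) - 2 * isqrt3) / (2 * isqrt3 * (-2 / (a + b)))"
    using nz' by (simp add: divide_simps) (simp add: algebra_simps)
  ultimately show ?thesis
    by (simp add: a_def)
qed

lemma isCont_wp_seed_denominator:
  "isCont (\<lambda>w. pseudo_factorial_egf (isqrt3 * w) + pseudo_factorial_egf (-(isqrt3 * w))) 0"
proof -
  have c: "isCont pseudo_factorial_egf 0"
    using has_field_derivative_pseudo_factorial_egf[of 0] DERIV_isCont[of pseudo_factorial_egf] by simp
  have "isCont (\<lambda>w. pseudo_factorial_egf (isqrt3 * w)) 0"
    by (rule isCont_o2[where g = pseudo_factorial_egf]) (simp_all add: c)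
  moreover have "isCont (\<lambda>w. pseudo_factorial_egf (-(isqrt3 * w))) 0"
    by (rule isCont_o2[where g = pseudo_factorial_egf]) (simp_all add: c)
  ultimately show ?thesis
    by (rule isCont_add)
qed

lemma eventually_wp_seed_regular:
  "eventually (\<lambda>w. norm (isqrt3 * w) < 1 \<and>
     pseudo_factorial_egf (isqrt3 * w) + pseudo_factorial_egf (-(isqrt3 * w)) \<noteq> 0) (nhds 0)"
proof -
  have *: "isCont (\<lambda>w. norm (isqrt3 * w)) 0"
    by (intro continuous_intros)
  show ?thesis
  proof (rule eventually_conj)
    show "eventually (\<lambda>w. norm (isqrt3 * w) < 1) (nhds 0)"
    proof -
      from * have "((\<lambda>w. norm (isqrt3 * w)) \<longlongrightarrow> norm (isqrt3 * 0)) (nhds 0)"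
        by (simp only: isCont_def tendsto_at_iff_tendsto_nhds[of "\<lambda>w. norm (isqrt3 * w)"])
      from order_tendstoD(2)[OF this, of 1] show ?thesis by simp
    qed
    show "eventually (\<lambda>w. pseudo_factorial_egf (isqrt3 * w) + pseudo_factorial_egf (-(isqrt3 * w)) \<noteq> 0)
        (nhds 0)"
      using isCont_wp_seed_denominator
      unfolding isCont_def tendsto_at_iff_tendsto_nhds[of "\<lambda>w. pseudo_factorial_egf (isqrt3 * w) +
        pseudo_factorial_egf (-(isqrt3 * w))"]
      by (rule tendsto_imp_eventually_ne) simp
  qed
qed

lemma wp_seed_analytic: "wp_seed analytic_on {0}"
proof -
  obtain r where r: "r > 0" "\<And>w. w \<in> ball 0 r \<Longrightarrow> norm (isqrt3 * w) < 1 \<and>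
     pseudo_factorial_egf (isqrt3 * w) + pseudo_factorial_egf (-(isqrt3 * w)) \<noteq> 0"
    using eventually_wp_seed_regular unfolding eventually_nhds_metric by (auto simp: dist_commute)
  have "wp_seed holomorphic_on ball 0 r"
    unfolding holomorphic_on_open[OF open_ball]
  proof
    fix w :: complex assume "w \<in> ball 0 r"
    from r(2)[OF this] show "\<exists>d. (wp_seed has_field_derivative d) (at w)"
      using wp_seed_has_field_derivative[of w] by blast
  qed
  thus ?thesis
    using r(1) by (auto simp: analytic_on_def)
qed

lemma tendsto_deriv_wp_seed: "(\<lambda>w. deriv wp_seed w / w) \<midarrow>0\<rightarrow> 6"
proof -
  have "(pseudo_factorial_egf has_field_derivative -1) (at (isqrt3 * 0))"
       "(pseudo_factorial_egf has_field_derivative -1) (at (-(isqrt3 * 0)))"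
    using has_field_derivative_pseudo_factorial_egf[of 0] by simp_all
  hence "((\<lambda>w. pseudo_factorial_egf (isqrt3 * w) - pseudo_factorial_egf (-(isqrt3 * w)))
       has_field_derivative -1 * isqrt3 - (-1) * (-isqrt3)) (at 0)"
    by (intro DERIV_diff DERIV_chain2[where f = pseudo_factorial_egf])
       (auto intro!: derivative_eq_intros)
  hence num: "(\<lambda>w. (pseudo_factorial_egf (isqrt3 * w) - pseudo_factorial_egf (-(isqrt3 * w))) / w)
      \<midarrow>0\<rightarrow> - 2 * isqrt3"
    by (simp add: DERIV_def)
  have den: "(\<lambda>w. pseudo_factorial_egf (isqrt3 * w) + pseudo_factorial_egf (-(isqrt3 * w))) \<midarrow>0\<rightarrow> 2"
    using isCont_wp_seed_denominator by (simp add: isCont_def)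
  have "(\<lambda>w. 2 * isqrt3 * ((pseudo_factorial_egf (isqrt3 * w) - pseudo_factorial_egf (-(isqrt3 * w))) / w) /
      (pseudo_factorial_egf (isqrt3 * w) + pseudo_factorial_egf (-(isqrt3 * w))))
      \<midarrow>0\<rightarrow> 2 * isqrt3 * (- 2 * isqrt3) / 2"
    by (intro tendsto_intros num den) auto
  moreover have "eventually (\<lambda>w. 2 * isqrt3 * ((pseudo_factorial_egf (isqrt3 * w) - pseudo_factorial_egf (-(isqrt3 * w))) / w) /
      (pseudo_factorial_egf (isqrt3 * w) + pseudo_factorial_egf (-(isqrt3 * w)))
      = deriv wp_seed w / w) (at 0)"
    using eventually_nhds_imp_at[OF eventually_wp_seed_regular]
  proof eventually_elim
    case (elim w)
    show ?case
      using DERIV_imp_deriv[OF wp_seed_has_field_derivative] elim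
      by (simp add: mult_ac)
  qed
  ultimately have "(\<lambda>w. deriv wp_seed w / w) \<midarrow>0\<rightarrow> 2 * isqrt3 * (- 2 * isqrt3) / 2"
    by (rule Lim_transform_eventually)
  also have "2 * isqrt3 * (- 2 * isqrt3) / 2 = -2 * isqrt3\<^sup>2"
    by (simp add: power2_eq_square)
  finally show ?thesis by simp
qed

text \<open>
  The effect on the \<open>x\<close>-coordinate of complex multiplication by \<open>\<i> sqrt 3\<close> on the curve
  \<open>y^2 = 4 x^3 + 4\<close>.
\<close>
definition wp_isogeny :: "complex \<Rightarrow> complex" where
  "wp_isogeny x = -(x ^ 3 + 4) / (3 * x\<^sup>2)"

lemma wp_isogeny_has_field_derivative:
  assumes "x \<noteq> 0"
  shows "(wp_isogeny has_field_derivative -(x ^ 3 - 8) / (3 * x ^ 3)) (at x)"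
proof -
  have "((\<lambda>x. -(x ^ 3 + 4)) has_field_derivative -(3 * x\<^sup>2)) (at x)"
       "((\<lambda>x. 3 * x\<^sup>2) has_field_derivative 6 * x) (at x)"
    by (auto intro!: derivative_eq_intros)
  from DERIV_divide[OF this] assms
  have "(wp_isogeny has_field_derivative
      (-(3 * x\<^sup>2) * (3 * x\<^sup>2) - -(x ^ 3 + 4) * (6 * x)) / (3 * x\<^sup>2 * (3 * x\<^sup>2))) (at x)"
    by (simp add: wp_isogeny_def [abs_def])
  moreover have "(-(3 * x\<^sup>2) * (3 * x\<^sup>2) - -(x ^ 3 + 4) * (6 * x)) = -(x ^ 3 - 8) * (3 * x)"
                "3 * x\<^sup>2 * (3 * x\<^sup>2) = (3 * x ^ 3) * (3 * x)"
    by algebra+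
  hence "(-(3 * x\<^sup>2) * (3 * x\<^sup>2) - -(x ^ 3 + 4) * (6 * x)) / (3 * x\<^sup>2 * (3 * x\<^sup>2))
      = -(x ^ 3 - 8) / (3 * x ^ 3)"
    using assms mult_divide_mult_cancel_right[of "3 * x" "-(x ^ 3 - 8)" "3 * x ^ 3"] by simp
  ultimately show ?thesis
    by (simp only:)
qed

lemma wp_isogeny_compose_has_field_derivative:
  assumes "(P has_field_derivative d) (at (w / isqrt3))" "P (w / isqrt3) \<noteq> 0"
  defines "x \<equiv> P (w / isqrt3)"
  shows "((\<lambda>w. wp_isogeny (P (w / isqrt3))) has_field_derivative
           -(x ^ 3 - 8) / (3 * x ^ 3) * (d / isqrt3)) (at w)"
  unfolding x_def
  by (intro DERIV_chain2[where f = wp_isogeny] wp_isogeny_has_field_derivative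
        DERIV_chain2[where f = P and g = "\<lambda>w. w / isqrt3" and Db = "1 / isqrt3", THEN DERIV_cong])
     (use assms in \<open>auto intro!: derivative_eq_intros\<close>)

text \<open>
  With \<open>S = wp_isogeny\<close>, the chain rule reduces the claim to \<open>S'(x)^2 (4 x^3 + 4) / (-3) = 4 S(x)^3 + 4\<close>,
  which for \<open>t = x^3\<close> is the factorisation \<open>(t + 4)^3 - 27 t^2 = (t - 8)^2 (t + 1)\<close>.
\<close>
lemma wp_ode_isogeny:
  assumes P: "P field_differentiable at (w / isqrt3)" "P (w / isqrt3) \<noteq> 0"
    and ode: "wp_ode P (w / isqrt3)"
  shows "wp_ode (\<lambda>w. wp_isogeny (P (w / isqrt3))) w"
proof -
  define x d where "x = P (w / isqrt3)" and "d = deriv P (w / isqrt3)"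
  have x: "x \<noteq> 0"
    using P by (simp add: x_def)
  have d: "d\<^sup>2 = 4 * x ^ 3 + 4"
    using ode by (simp add: wp_ode_def x_def d_def)
  have "deriv (\<lambda>w. wp_isogeny (P (w / isqrt3))) w = -(x ^ 3 - 8) / (3 * x ^ 3) * (d / isqrt3)"
    unfolding x_def d_def
    by (intro DERIV_imp_deriv wp_isogeny_compose_has_field_derivative) (use P in \<open>simp_all add: field_differentiable_derivI\<close>)
  hence "(deriv (\<lambda>w. wp_isogeny (P (w / isqrt3))) w)\<^sup>2 =
      (x ^ 3 - 8)\<^sup>2 * d\<^sup>2 / ((3 * x ^ 3)\<^sup>2 * isqrt3\<^sup>2)"
    by (simp add: power_divide power_mult_distrib power2_commute[of 8])
  also have "\<dots> = 4 * wp_isogeny x ^ 3 + 4"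
    unfolding d isqrt3_power2 wp_isogeny_def using x
    by (simp add: power_divide divide_simps) (simp add: algebra_simps power_numeral_reduce)
  finally show ?thesis
    by (simp add: wp_ode_def x_def)
qed

text \<open>
  Both sides solve the same equation near 0. The isogeny fixes -1 and has derivative -3 there, which
  cancels the factor \<open>-3 = (\<i> sqrt 3)^2\<close> by which the second derivative is divided, so that the
  initial data agree too.
\<close>
lemma wp_seed_isogeny: "eventually (\<lambda>w. wp_isogeny (wp_seed (w / isqrt3)) = wp_seed w) (nhds 0)"
proof -
  let ?Q = "\<lambda>w. wp_isogeny (wp_seed (w / isqrt3))"
  have lim: "filterlim (\<lambda>w. w / isqrt3) (nhds 0) (nhds 0)"
  proof -
    have "(\<lambda>w. w / isqrt3) \<midarrow>0\<rightarrow> 0 / isqrt3"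
      by (intro tendsto_intros) auto
    thus ?thesis
      by (simp add: tendsto_nhds_iff)
  qed
  have lim': "filterlim (\<lambda>w. w / isqrt3) (at 0) (at 0)"
    using lim unfolding filterlim_at tendsto_nhds_iff by (auto simp: eventually_at_filter)
  have reg: "eventually (\<lambda>w. wp_seed field_differentiable at w \<and> wp_seed w \<noteq> 0 \<and> wp_ode wp_seed w) (nhds 0)"
    using eventually_wp_seed_regular
  proof eventually_elim
    case (elim w)
    thus ?case
      using wp_seed_has_field_derivative[of w] wp_seed_ode[of w]
      by (auto simp: field_differentiable_def wp_seed_def)
  qed
  have reg': "eventually (\<lambda>w. wp_seed field_differentiable at (w / isqrt3) \<and> wp_seed (w / isqrt3) \<noteq> 0 \<and>
      wp_ode wp_seed (w / isqrt3)) (nhds 0)"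
    using eventually_compose_filterlim[OF reg lim] .
  have Q_0: "?Q 0 = -1"
    by (simp add: wp_seed_0 wp_isogeny_def)
  have "eventually (\<lambda>w. ?Q w = wp_seed w) (at 0)"
  proof (rule wp_ode_unique_half_period)
    obtain r where r: "r > 0" "\<And>w. w \<in> ball 0 r \<Longrightarrow> wp_seed field_differentiable at (w / isqrt3) \<and>
        wp_seed (w / isqrt3) \<noteq> 0"
      using reg' unfolding eventually_nhds_metric by (auto simp: dist_commute)
    have "?Q holomorphic_on ball 0 r"
      unfolding holomorphic_on_open[OF open_ball]
    proof
      fix w :: complex assume "w \<in> ball 0 r"
      from r(2)[OF this] obtain d where "(wp_seed has_field_derivative d) (at (w / isqrt3))"
          "wp_seed (w / isqrt3) \<noteq> 0"
        by (auto simp: field_differentiable_def)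
      from wp_isogeny_compose_has_field_derivative[OF this] show "\<exists>d. (?Q has_field_derivative d) (at w)"
        by blast
    qed
    thus "?Q analytic_on {0}"
      using r(1) by (auto simp: analytic_on_def)
    show "eventually (wp_ode ?Q) (at 0)"
      using eventually_nhds_imp_at[OF reg'] by eventually_elim (auto intro: wp_ode_isogeny)
    show "eventually (wp_ode wp_seed) (at 0)"
      using eventually_nhds_imp_at[OF reg] by eventually_elim auto
    have cont: "(\<lambda>w. wp_seed (w / isqrt3)) \<midarrow>0\<rightarrow> -1"
      using filterlim_compose[OF isContD[OF analytic_at_imp_isCont[OF wp_seed_analytic]] lim']
      by (simp add: wp_seed_0)
    have "(\<lambda>w. -(wp_seed (w / isqrt3) ^ 3 - 8) / (3 * wp_seed (w / isqrt3) ^ 3) *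
        (deriv wp_seed (w / isqrt3) / (w / isqrt3)) / isqrt3\<^sup>2)
        \<midarrow>0\<rightarrow> -((-1) ^ 3 - 8) / (3 * (-1) ^ 3) * 6 / isqrt3\<^sup>2"
      by (intro tendsto_intros cont filterlim_compose[OF tendsto_deriv_wp_seed lim']) auto
    moreover have "eventually (\<lambda>w. -(wp_seed (w / isqrt3) ^ 3 - 8) / (3 * wp_seed (w / isqrt3) ^ 3) *
        (deriv wp_seed (w / isqrt3) / (w / isqrt3)) / isqrt3\<^sup>2 = deriv ?Q w / w) (at 0)"
      using eventually_nhds_imp_at[OF reg']
    proof eventually_elim
      case (elim w)
      have "deriv ?Q w = -(wp_seed (w / isqrt3) ^ 3 - 8) / (3 * wp_seed (w / isqrt3) ^ 3) *
          (deriv wp_seed (w / isqrt3) / isqrt3)"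
        by (intro DERIV_imp_deriv wp_isogeny_compose_has_field_derivative) (use elim in \<open>simp_all add: field_differentiable_derivI\<close>)
      thus ?case
        by (simp add: power2_eq_square)
    qed
    ultimately have "(\<lambda>w. deriv ?Q w / w) \<midarrow>0\<rightarrow> -((-1) ^ 3 - 8) / (3 * (-1) ^ 3) * 6 / isqrt3\<^sup>2"
      by (rule Lim_transform_eventually)
    thus "(\<lambda>w. deriv ?Q w / w) \<midarrow>0\<rightarrow> 6"
      by simp
  qed (use wp_seed_analytic wp_seed_0 tendsto_deriv_wp_seed Q_0 in auto)
  thus ?thesis
    unfolding eventually_at_filter
  proof eventually_elim
    case (elim w)
    thus ?case
      using Q_0 wp_seed_0 by (cases "w = 0") auto
  qed
qed

section \<open>Continuation to the whole plane by complex multiplication\<close>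

text \<open>
  A functional equation \<open>g(c w) = S(g(w))\<close> with \<open>|c| > 1\<close> determines \<open>g\<close> on a disc from its values on
  a disc smaller by the factor \<open>|c|\<close>. Iterating it covers the plane.
\<close>
lemma meromorphic_extension_by_scaling:
  assumes mero: "\<And>A g. g meromorphic_on A \<Longrightarrow> (\<lambda>z. S (g z)) meromorphic_on A"
    and c: "norm c > 1" and r: "r > 0"
    and g: "g meromorphic_on ball 0 r"
    and eq: "\<And>w. w \<in> ball 0 r \<Longrightarrow> S (g (w / c)) = g w"
  obtains p where "p meromorphic_on UNIV"
    "\<And>n w. norm w < r * norm c ^ n \<Longrightarrow> p w = (S ^^ n) (g (w / c ^ n))"
proof -
  define a where "a n w = (S ^^ n) (g (w / c ^ n))" for n w
  have c0: "c \<noteq> 0" using c by auto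
  have a_Suc: "a (Suc n) w = a n w" if "norm w < r * norm c ^ n" for n w
  proof -
    have "norm (w / c ^ n) < r"
      using that c0 by (simp add: norm_divide norm_power divide_less_eq)
    hence "S (g (w / c ^ n / c)) = g (w / c ^ n)"
      by (intro eq) simp
    moreover have "w / c ^ n / c = w / c ^ Suc n"
      by simp
    ultimately show ?thesis
      unfolding a_def by (simp only: funpow_Suc_right o_apply)
  qed
  have mono: "r * norm c ^ n \<le> r * norm c ^ m" if "n \<le> m" for n m
    using c r that by (intro mult_left_mono power_increasing) auto
  have const: "a m w = a n w" if "norm w < r * norm c ^ n" "n \<le> m" for n m w
    using that(2)
  proof (induction m rule: dec_induct)
    case (step m)
    have "norm w < r * norm c ^ m"
      using that(1) mono[OF step(1)] by linarith
    from a_Suc[OF this] step(3) show ?case by simp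
  qed simp
  define p where "p w = lim (\<lambda>n. a n w)" for w
  have p: "p w = a n w" if "norm w < r * norm c ^ n" for n w
  proof -
    have "eventually (\<lambda>m. a m w = a n w) sequentially"
      using eventually_ge_at_top[of n] by eventually_elim (rule const[OF that])
    hence "(\<lambda>m. a m w) \<longlonglongrightarrow> a n w"
      by (rule tendsto_eventually)
    thus ?thesis
      unfolding p_def by (rule limI)
  qed
  have S_pow: "(\<lambda>z. (S ^^ n) (h z)) meromorphic_on A" if "h meromorphic_on A" for n h A
  proof (induction n)
    case (Suc n)
    from mero[OF Suc] show ?case by simp
  qed (simp add: that)
  have "p meromorphic_on ball 0 (r * norm c ^ n)" for n
  proof -
    have "(\<lambda>w. g (w / c ^ n)) meromorphic_on ball 0 (r * norm c ^ n)"
      by (rule meromorphic_on_compose[OF g])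
         (use c0 in \<open>auto intro!: analytic_intros simp: norm_divide norm_power divide_less_eq\<close>)
    hence "a n meromorphic_on ball 0 (r * norm c ^ n)"
      unfolding a_def [abs_def] by (rule S_pow)
    moreover have "eventually (\<lambda>w. p w = a n w) (at z)" if "z \<in> ball 0 (r * norm c ^ n)" for z
      using eventually_at_in_open'[OF open_ball that] by eventually_elim (rule p, simp)
    ultimately show ?thesis
      using meromorphic_on_cong[of "ball 0 (r * norm c ^ n)" p "a n"] by blast
  qed
  hence "p meromorphic_on (\<Union>n. ball 0 (r * norm c ^ n))"
    by (intro meromorphic_on_UN)
  moreover have "(\<Union>n. ball 0 (r * norm c ^ n)) = (UNIV :: complex set)"
  proof -
    have "\<exists>n. norm w < r * norm c ^ n" for w :: complex
      using real_arch_pow[OF c, of "norm w / r"] r by (auto simp: divide_less_eq mult.commute)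
    thus ?thesis by auto
  qed
  ultimately show thesis
    using that p unfolding a_def by simp
qed

lemma meromorphic_eventually_0_at:
  assumes "h meromorphic_on UNIV" and "eventually (\<lambda>z. h z = 0) (at a)"
  shows "eventually (\<lambda>z. h z = 0) (at z)"
proof -
  have "(\<forall>\<^sub>\<approx>x\<in>UNIV. h x = 0) \<or> (\<forall>\<^sub>\<approx>x\<in>UNIV. h x \<noteq> 0)"
    by (rule meromorphic_imp_constant_or_avoid[OF assms(1)]) auto
  thus ?thesis
  proof
    assume "\<forall>\<^sub>\<approx>x\<in>UNIV. h x = 0"
    thus ?thesis
      by (simp add: eventually_cosparse_open_eq)
  next
    assume "\<forall>\<^sub>\<approx>x\<in>UNIV. h x \<noteq> 0"
    hence "eventually (\<lambda>x. h x \<noteq> 0) (at a)"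
      by (simp add: eventually_cosparse_open_eq)
    hence "eventually (\<lambda>x. False) (at a)"
      using assms(2) by eventually_elim simp
    thus ?thesis by simp
  qed
qed

text \<open>
  For a nicely meromorphic function each value, at poles too, is determined by nearby values; this
  turns identities near a point into identities everywhere.
\<close>
lemma nicely_meromorphic_eq_remove_sings:
  assumes "h nicely_meromorphic_on UNIV"
  shows "h z = remove_sings h z"
proof (cases "is_pole h z")
  case True
  thus ?thesis
    using is_pole_zero_at_nicely_mero[OF assms True] by simp
next
  case False
  thus ?thesis
    using nicely_meromorphic_on_imp_analytic_at[OF assms _ False] by simp
qed

lemma nicely_meromorphic_eq_if_eq_near:
  assumes "f nicely_meromorphic_on UNIV" "g nicely_meromorphic_on UNIV"
    and "eventually (\<lambda>z. f z = g z) (at a)"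
  shows "f = g"
proof
  fix z
  have "(\<lambda>z. f z - g z) meromorphic_on UNIV"
    using assms(1,2) by (intro meromorphic_intros) (auto simp: nicely_meromorphic_on_def)
  from meromorphic_eventually_0_at[OF this, of a z] assms(3)
  have "eventually (\<lambda>x. f x = g x) (at z)"
    by simp
  thus "f z = g z"
    using nicely_meromorphic_eq_remove_sings assms(1,2) remove_sings_cong by metis
qed

lemma wp_ode_global:
  assumes f: "f nicely_meromorphic_on UNIV" and ode: "eventually (wp_ode f) (at a)"
    and z: "\<not> is_pole f z"
  shows "wp_ode f z"
proof -
  let ?h = "\<lambda>z. (deriv f z)\<^sup>2 - (4 * f z ^ 3 + 4)"
  have "?h meromorphic_on UNIV"
    using f by (intro meromorphic_intros) (auto simp: nicely_meromorphic_on_def)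
  from meromorphic_eventually_0_at[OF this, of a z] ode
  have "eventually (\<lambda>x. ?h x = 0) (at z)"
    by (simp add: wp_ode_def [abs_def])
  hence "?h \<midarrow>z\<rightarrow> 0"
    by (rule tendsto_eventually)
  moreover have "f analytic_on {z}"
    using nicely_meromorphic_on_imp_analytic_at[OF f _ z] by simp
  hence "?h analytic_on {z}"
    by (intro analytic_intros)
  hence "?h \<midarrow>z\<rightarrow> ?h z"
    by (intro isContD analytic_at_imp_isCont)
  ultimately have "?h z = 0"
    using LIM_unique by blast
  thus ?thesis
    by (simp add: wp_ode_def)
qed

lemma filtermap_affine_at:
  fixes c :: complex
  assumes "c \<noteq> 0"
  shows "filtermap (\<lambda>z. c * z + d) (at z) = at (c * z + d)"
proof (rule filtermap_fun_inverse[where g = "\<lambda>w. (w - d) / c"])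
  have "(\<lambda>w. (w - d) / c) \<midarrow>c * z + d\<rightarrow> (c * z + d - d) / c"
    by (intro tendsto_intros assms)
  moreover have "eventually (\<lambda>w. (w - d) / c \<noteq> z) (at (c * z + d))"
    unfolding eventually_at_filter
  proof (intro always_eventually allI impI notI)
    fix w assume "w \<noteq> c * z + d" "(w - d) / c = z"
    thus False
      using assms by (simp add: divide_eq_eq diff_eq_eq mult.commute)
  qed
  ultimately show "filterlim (\<lambda>w. (w - d) / c) (at z) (at (c * z + d))"
    using assms by (simp add: filterlim_at)
  have "(\<lambda>z. c * z + d) \<midarrow>z\<rightarrow> c * z + d"
    by (intro tendsto_intros)
  moreover have "eventually (\<lambda>w. c * w + d \<noteq> c * z + d) (at z)"
    using assms by (auto simp: eventually_at_filter)
  ultimately show "filterlim (\<lambda>z. c * z + d) (at (c * z + d)) (at z)"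
    by (simp add: filterlim_at)
  show "eventually (\<lambda>w. c * ((w - d) / c) + d = w) (at (c * z + d))"
    using assms by simp
qed

lemma nicely_meromorphic_on_compose_affine:
  assumes "f nicely_meromorphic_on UNIV" "c \<noteq> 0"
  shows "(\<lambda>z. f (c * z + d)) nicely_meromorphic_on UNIV"
proof -
  have "(\<lambda>z. f (c * z + d)) meromorphic_on UNIV"
  proof (rule meromorphic_on_compose[of f UNIV])
    show "f meromorphic_on UNIV"
      using assms(1) by (simp add: nicely_meromorphic_on_def)
    show "(\<lambda>z. c * z + d) analytic_on UNIV"
      by (intro analytic_intros)
  qed auto
  moreover have "(is_pole (\<lambda>z. f (c * z + d)) z \<and> f (c * z + d) = 0) \<or> (\<lambda>z. f (c * z + d)) \<midarrow>z\<rightarrow> f (c * z + d)" for z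
  proof -
    have "(is_pole f (c * z + d) \<and> f (c * z + d) = 0) \<or> f \<midarrow>c * z + d\<rightarrow> f (c * z + d)"
      using assms(1) by (auto simp: nicely_meromorphic_on_def)
    thus ?thesis
      unfolding is_pole_def filtermap_affine_at[OF assms(2), of d z, symmetric] filterlim_filtermap .
  qed
  ultimately show ?thesis
    by (auto simp: nicely_meromorphic_on_def)
qed

lemma is_pole_compose_affine:
  fixes f :: "complex \<Rightarrow> complex"
  assumes "c \<noteq> 0"
  shows "is_pole (\<lambda>z. f (c * z + d)) z \<longleftrightarrow> is_pole f (c * z + d)"
  unfolding is_pole_def filtermap_affine_at[OF assms, of d z, symmetric] filterlim_filtermap ..

text \<open>
  Continuity away from the poles and the value 0 at them are part of the notion, so that two solutions
  that agree near a point are equal as functions, and not only up to a discrete set.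
\<close>
definition wp_solution :: "(complex \<Rightarrow> complex) \<Rightarrow> bool" where
  "wp_solution P \<longleftrightarrow> P nicely_meromorphic_on UNIV \<and> (\<forall>z. \<not> is_pole P z \<longrightarrow> wp_ode P z)"

lemma wp_solution_analytic: "wp_solution P \<Longrightarrow> \<not> is_pole P z \<Longrightarrow> P analytic_on {z}"
  using nicely_meromorphic_on_imp_analytic_at[of P UNIV z] by (simp add: wp_solution_def)

lemma wp_solution_meromorphic: "wp_solution P \<Longrightarrow> P meromorphic_on A"
  using meromorphic_on_subset[of P UNIV A] by (simp add: wp_solution_def nicely_meromorphic_on_def)

lemma wp_solution_eventually_ode:
  assumes "wp_solution P"
  shows "eventually (wp_ode P) (at z)"
proof -
  have "isolated_singularity_at P z"
    using wp_solution_meromorphic[OF assms, of "{z}"] by (simp add: meromorphic_at_iff)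
  hence "eventually (\<lambda>w. P analytic_on {w}) (at z)"
    by (simp add: isolated_singularity_at_altdef)
  thus ?thesis
  proof eventually_elim
    case (elim w)
    hence "\<not> is_pole P w"
      by (rule analytic_at_imp_no_pole)
    thus ?case
      using assms by (simp add: wp_solution_def)
  qed
qed

lemma remove_sings_cnj:
  assumes "\<And>z. f (cnj z) = cnj (f z)"
  shows "remove_sings f (cnj z) = cnj (remove_sings f z)"
proof -
  have lim: "f \<midarrow>cnj z\<rightarrow> cnj l" if "f \<midarrow>z\<rightarrow> l" for z l
  proof -
    have "filterlim cnj (at z) (at (cnj z))"
      unfolding filterlim_at
    proof
      show "cnj \<midarrow>cnj z\<rightarrow> z"
        using tendsto_cnj[OF tendsto_ident_at[of "cnj z" UNIV]] by simp
      show "eventually (\<lambda>x. cnj x \<in> UNIV \<and> cnj x \<noteq> z) (at (cnj z))"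
        by (auto simp: eventually_at_filter intro!: always_eventually)
    qed
    from filterlim_compose[OF that this] have "(\<lambda>w. cnj (f (cnj w))) \<midarrow>cnj z\<rightarrow> cnj l"
      by (rule tendsto_cnj)
    thus ?thesis by (simp add: assms)
  qed
  show ?thesis
  proof (cases "\<exists>l. f \<midarrow>z\<rightarrow> l")
    case True
    thus ?thesis
      using lim remove_sings_eqI by metis
  next
    case False
    hence "\<not> (\<exists>l. f \<midarrow>cnj z\<rightarrow> l)"
      using lim[where z = "cnj z"] by auto
    thus ?thesis
      using False by (simp add: remove_sings_def)
  qed
qed

lemma eventually_analytic_at:
  assumes "f analytic_on {z}"
  shows "eventually (\<lambda>w. f analytic_on {w}) (nhds z)"
proof -
  obtain S where S: "open S" "z \<in> S" "f holomorphic_on S"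
    using assms by (auto simp: analytic_at)
  show ?thesis
    using eventually_nhds_in_open[OF S(1,2)]
  proof eventually_elim
    case (elim w)
    thus ?case
      using S(1,3) analytic_at by blast
  qed
qed

text \<open>
  The continuation is even and commutes with complex conjugation because the germ does: conjugation
  maps \<open>\<i> sqrt 3\<close> to its negative, and evenness absorbs the signs that arise in the iteration.
\<close>
lemma wp_shifted_exists:
  obtains p where "wp_solution p"
    "eventually (\<lambda>w. p w = wp_seed w) (nhds 0)"
    "\<And>z. p (-z) = p z" "\<And>z. p (cnj z) = cnj (p z)"
proof -
  have "eventually (\<lambda>w. wp_isogeny (wp_seed (w / isqrt3)) = wp_seed w \<and> norm (isqrt3 * w) < 1 \<and>
      wp_seed analytic_on {w} \<and> wp_ode wp_seed w) (nhds 0)"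
    using wp_seed_isogeny eventually_wp_seed_regular eventually_analytic_at[OF wp_seed_analytic] 
    by eventually_elim (auto intro: wp_seed_ode)
  then obtain r where r: "r > 0" "\<And>w. w \<in> ball 0 r \<Longrightarrow> wp_isogeny (wp_seed (w / isqrt3)) = wp_seed w"
      "\<And>w. w \<in> ball 0 r \<Longrightarrow> norm (isqrt3 * w) < 1" "\<And>w. w \<in> ball 0 r \<Longrightarrow> wp_seed analytic_on {w}"
      "\<And>w. w \<in> ball 0 r \<Longrightarrow> wp_ode wp_seed w"
    unfolding eventually_nhds_metric by (auto simp: dist_commute)
  have "wp_seed analytic_on ball 0 r"
    using r(4) analytic_on_analytic_at by blast
  hence "wp_seed meromorphic_on ball 0 r"
    by (rule analytic_on_imp_meromorphic_on)
  moreover have "(\<lambda>z. wp_isogeny (g z)) meromorphic_on A" if "g meromorphic_on A" for g A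
    unfolding wp_isogeny_def using that by (intro meromorphic_intros)
  moreover have "norm isqrt3 > 1"
    by (simp add: norm_isqrt3)
  ultimately obtain q where q: "q meromorphic_on UNIV"
    "\<And>n w. norm w < r * norm isqrt3 ^ n \<Longrightarrow> q w = (wp_isogeny ^^ n) (wp_seed (w / isqrt3 ^ n))"
    using meromorphic_extension_by_scaling[of wp_isogeny isqrt3 r wp_seed] r(1,2) by metis
  have q_seed: "q w = wp_seed w" if "w \<in> ball 0 r" for w
    using q(2)[of w 0] that by simp
  have isogeny_cnj: "(wp_isogeny ^^ n) (cnj x) = cnj ((wp_isogeny ^^ n) x)" for n x
    by (induction n) (simp_all add: wp_isogeny_def)
  have q_cnj: "q (cnj w) = cnj (q w)" for w
  proof -
    obtain n where n: "norm w < r * norm isqrt3 ^ n"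
      using real_arch_pow[of "norm isqrt3" "norm w / r"] r(1) by (auto simp: field_simps norm_isqrt3)
    define v where "v = w / isqrt3 ^ n"
    have v: "norm (isqrt3 * v) < 1"
      using n by (intro r(3)) (simp add: v_def norm_divide norm_power field_simps norm_isqrt3)
    have "cnj w / isqrt3 ^ n = (-1) ^ n * cnj v"
      by (simp add: v_def power_minus[of isqrt3] field_simps)
    hence "wp_seed (cnj w / isqrt3 ^ n) = wp_seed (cnj v)"
      by (cases "even n") (simp_all add: wp_seed_minus)
    also have "\<dots> = cnj (wp_seed v)"
      by (rule wp_seed_cnj[OF v])
    finally have "(wp_isogeny ^^ n) (wp_seed (cnj w / isqrt3 ^ n)) = cnj ((wp_isogeny ^^ n) (wp_seed v))"
      by (simp add: isogeny_cnj)
    thus ?thesis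
      using q(2)[of w n] q(2)[of "cnj w" n] n by (simp add: v_def)
  qed
  define p where "p = remove_sings q"
  have p: "p nicely_meromorphic_on UNIV"
    unfolding p_def by (rule remove_sings_nicely_meromorphic) fact
  have in_ball: "eventually (\<lambda>w. w \<in> ball 0 r) (nhds (0::complex))"
    using r(1) by (intro eventually_nhds_in_open) auto
  have p_seed: "eventually (\<lambda>w. p w = wp_seed w) (nhds 0)"
  proof -
    have "q analytic_on {0}"
      using analytic_at_cong[OF eventually_mono[OF in_ball q_seed] refl] wp_seed_analytic by simp
    from eventually_remove_sings_eq_nhds[OF this] in_ball show ?thesis
      unfolding p_def by eventually_elim (use q_seed in auto)
  qed
  have ode: "eventually (wp_ode p) (nhds 0)"
  proof -
    have "eventually (\<lambda>z. eventually (\<lambda>w. p w = wp_seed w) (nhds z)) (nhds 0)"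
      using p_seed by (simp add: eventually_eventually)
    thus ?thesis
      using p_seed in_ball
    proof eventually_elim
      case (elim z)
      have "deriv p z = deriv wp_seed z"
        using elim(1) by (rule deriv_cong_ev) simp
      thus ?case
        using elim r(5)[of z] by (simp add: wp_ode_def)
    qed
  qed
  have even: "(\<lambda>z. p (-z)) = p"
  proof (rule nicely_meromorphic_eq_if_eq_near[OF _ p])
    show "(\<lambda>z. p (-z)) nicely_meromorphic_on UNIV"
      using nicely_meromorphic_on_compose_affine[OF p, of "-1" 0] by simp
    have "filterlim uminus (nhds 0) (nhds (0::complex))"
      using tendsto_minus[OF filterlim_ident[of "nhds (0::complex)"]] by simp
    from eventually_compose_filterlim[OF p_seed this]
    have "eventually (\<lambda>w. p (-w) = wp_seed (-w)) (nhds 0)" .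
    with p_seed have "eventually (\<lambda>w. p (-w) = p w) (nhds 0)"
      by eventually_elim (simp add: wp_seed_minus)
    thus "eventually (\<lambda>w. p (-w) = p w) (at 0)"
      by (rule eventually_nhds_imp_at)
  qed
  show thesis
  proof (rule that[OF _ p_seed])
    show "wp_solution p"
      using p wp_ode_global[OF p eventually_nhds_imp_at[OF ode]] by (simp add: wp_solution_def)
    show "p (-z) = p z" for z
      using fun_cong[OF even, of z] .
    show "p (cnj z) = cnj (p z)" for z
      unfolding p_def by (rule remove_sings_cnj) (rule q_cnj)
  qed
qed

text \<open>
  The homogeneity of the equation: replacing \<open>P(z)\<close> by \<open>k P(c z)\<close> multiplies the cubic
  term by \<open>k^3\<close> and the squared derivative by \<open>(k c)^2\<close>. The cases of interest are translations,
  \<open>z\<close> to \<open>-z\<close>, and rotation by a cube root of unity.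
\<close>
lemma wp_solution_affine:
  assumes P: "wp_solution P" and k: "k ^ 3 = 1" "(k * c)\<^sup>2 = 1"
  shows "wp_solution (\<lambda>z. k * P (c * z + d))"
  unfolding wp_solution_def
proof (intro conjI allI impI)
  have c: "c \<noteq> 0" and k0: "k \<noteq> 0"
    using k by auto
  show "(\<lambda>z. k * P (c * z + d)) nicely_meromorphic_on UNIV"
    by (intro nicely_meromorphic_on_cmult_left nicely_meromorphic_on_compose_affine c)
       (use P in \<open>simp add: wp_solution_def\<close>)
  fix z assume np: "\<not> is_pole (\<lambda>z. k * P (c * z + d)) z"
  have "(\<lambda>z. k * P (c * z + d)) analytic_on {z}"
    by (rule nicely_meromorphic_on_imp_analytic_at[OF \<open>(\<lambda>z. k * P (c * z + d)) nicely_meromorphic_on UNIV\<close> _ np]) simp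
  from analytic_on_mult[OF analytic_on_const[of "1 / k"] this]
  have "(\<lambda>z. P (c * z + d)) analytic_on {z}"
    using k0 by simp
  hence "\<not> is_pole P (c * z + d)"
    using is_pole_compose_affine[OF c] analytic_at_imp_no_pole by blast
  hence an: "P analytic_on {c * z + d}" and ode: "wp_ode P (c * z + d)"
    using P wp_solution_analytic by (auto simp: wp_solution_def)
  have "(P has_field_derivative deriv P (c * z + d)) (at (c * z + d))"
    using an by (simp add: analytic_on_imp_differentiable_at DERIV_deriv_iff_field_differentiable)
  moreover have "((\<lambda>z. c * z + d) has_field_derivative c) (at z)"
    by (auto intro!: derivative_eq_intros)
  ultimately have "((\<lambda>z. k * P (c * z + d)) has_field_derivative k * (deriv P (c * z + d) * c)) (at z)"
    by (intro DERIV_cmult DERIV_chain2[where f = P])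
  hence "deriv (\<lambda>z. k * P (c * z + d)) z = k * c * deriv P (c * z + d)"
    using DERIV_imp_deriv by fastforce
  hence "(deriv (\<lambda>z. k * P (c * z + d)) z)\<^sup>2 = (k * c)\<^sup>2 * (deriv P (c * z + d))\<^sup>2"
    by (simp add: power_mult_distrib)
  also have "\<dots> = 4 * (k ^ 3 * P (c * z + d) ^ 3) + 4"
    using ode k by (simp add: wp_ode_def)
  also have "\<dots> = 4 * (k * P (c * z + d)) ^ 3 + 4"
    by (simp add: power_mult_distrib)
  finally show "wp_ode (\<lambda>z. k * P (c * z + d)) z"
    by (simp add: wp_ode_def)
qed

section \<open>Beta values and the elliptic integral\<close>

lemma Gamma_legendre_duplication_real:
  assumes "x > (0::real)"
  shows "Gamma x * Gamma (x + 1 / 2) = 2 powr (1 - 2 * x) * sqrt pi * Gamma (2 * x)"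
proof -
  have pos: "complex_of_real y \<notin> \<int>\<^sub>\<le>\<^sub>0" if "y > 0" for y
    using that by (auto simp: of_real_in_nonpos_Ints_iff elim!: nonpos_Ints_cases)
  have "complex_of_real (Gamma x * Gamma (x + 1 / 2)) =
      Gamma (of_real x) * Gamma (of_real x + 1 / 2)"
    by (simp flip: Gamma_complex_of_real)
  also have "\<dots> = exp ((1 - 2 * of_real x) * of_real (ln 2)) * of_real (sqrt pi) * Gamma (2 * of_real x)"
    using Gamma_legendre_duplication[of "complex_of_real x"] pos[of x] pos[of "x + 1 / 2"] assms by simp
  also have "\<dots> = of_real (exp ((1 - 2 * x) * ln 2) * sqrt pi * Gamma (2 * x))"
    by (simp flip: Gamma_complex_of_real exp_of_real)
  also have "exp ((1 - 2 * x) * ln 2) = 2 powr (1 - 2 * x)"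
    by (simp add: powr_def)
  finally show ?thesis
    by (simp only: of_real_eq_iff)
qed

lemma Gamma_reflection_real: "Gamma x * Gamma (1 - x) = pi / sin (pi * x)" for x :: real
proof -
  have "complex_of_real (Gamma x * Gamma (1 - x)) = Gamma (of_real x) * Gamma (1 - of_real x)"
    by (simp flip: Gamma_complex_of_real)
  also have "\<dots> = of_real pi / sin (of_real pi * of_real x)"
    by (rule Gamma_reflection_complex)
  also have "\<dots> = of_real (pi / sin (pi * x))"
    by (simp flip: sin_of_real)
  finally show ?thesis
    by (simp only: of_real_eq_iff)
qed

lemma Beta_third_third: "Beta (1/3) (1/3) = sqrt 3 / (2 * pi) * Gamma (1/3 :: real) ^ 3"
proof -
  define g h where "g = Gamma (1/3 :: real)" and "h = Gamma (2/3 :: real)"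
  have pos: "g > 0" "h > 0"
    unfolding g_def h_def by (intro Gamma_real_pos; simp)+
  have "g * h = pi / sin (pi / 3)"
    unfolding g_def h_def using Gamma_reflection_real[of "1/3"] by simp
  hence "g * h * sqrt 3 = 2 * pi"
    by (simp add: sin_60)
  hence "sqrt 3 / (2 * pi) * g ^ 3 = sqrt 3 / (g * h * sqrt 3) * g ^ 3"
    by simp
  also have "\<dots> = g * g / h"
    using pos by (simp add: power3_eq_cube)
  finally show ?thesis
    by (simp add: Beta_def g_def h_def)
qed

lemma Beta_third_half: "Beta (1/3) (1/2) = 2 powr (-1/3) * Beta (1/3) (1/3 :: real)"
proof -
  define g h k t where "g = Gamma (1/3 :: real)" and "h = Gamma (2/3 :: real)"
    and "k = Gamma (5/6 :: real)" and "t = (2::real) powr (1/3)"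
  have "h > 0" "k > 0" "t > 0"
    unfolding h_def k_def t_def by (simp_all add: Gamma_real_pos)
  hence nz: "h \<noteq> 0" "k \<noteq> 0" "t \<noteq> 0"
    by simp_all
  have "g * k = t * sqrt pi * h"
    unfolding g_def h_def k_def t_def using Gamma_legendre_duplication_real[of "1/3"] by simp
  hence "g * (t * sqrt pi * h) = g * (g * k)"
    by simp
  hence "g * sqrt pi / k = g * g / (h * t)"
    using nz by (simp add: frac_eq_eq mult_ac)
  moreover have "(2::real) powr (-1/3) = 1 / t"
    unfolding t_def by (simp only: minus_divide_left[symmetric] powr_minus inverse_eq_divide)
  ultimately show ?thesis
    by (simp add: Beta_def Gamma_one_half_real g_def h_def k_def)
qed

lemma Beta_third_sixth: "Beta (1/3) (1/6) = 2 * Beta (1/3) (1/2 :: real)"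
proof -
  define g k l s where "g = Gamma (1/3 :: real)" and "k = Gamma (5/6 :: real)"
    and "l = Gamma (1/6 :: real)" and "s = sqrt pi"
  have "k > 0" "s > 0"
    unfolding k_def s_def by (simp_all add: Gamma_real_pos)
  hence nz: "k \<noteq> 0" "s \<noteq> 0"
    by simp_all
  have "l * k = 2 * (s * s)"
    unfolding k_def l_def s_def using Gamma_reflection_real[of "1/6"] by (simp add: sin_30)
  hence "g * l / s = 2 * (g * s / k)"
    using nz by (simp add: frac_eq_eq mult_ac)
  thus ?thesis
    by (simp add: Beta_def Gamma_one_half_real g_def k_def l_def s_def)
qed

lemma powr_neg_two_thirds: "(y::real) powr (-2/3) = 1 / y powr (2/3)"
proof -
  have "y powr (-2/3) = y powr (-(2/3))" by (simp only: minus_divide_left)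
  thus ?thesis by (simp only: powr_minus inverse_eq_divide)
qed
lemma cube_powr_neg_two_thirds: "y > 0 \<Longrightarrow> (y ^ 3) powr (-2/3) = 1 / (y::real)\<^sup>2"
proof -
  assume "y > 0"
  have "(y ^ 3) powr (-2/3) = (y powr 3) powr (-2/3)"
    using \<open>y > 0\<close> by simp
  also have "\<dots> = y powr (- 2)"
    by (subst powr_powr) simp
  also have "\<dots> = 1 / y powr 2"
    by (simp only: powr_minus inverse_eq_divide)
  also have "y powr 2 = y\<^sup>2"
    using \<open>y > 0\<close> by simp
  finally show ?thesis .
qed

text \<open>
  The first parameter is fixed at \<open>1/3\<close>, the exponent produced by the cube as new variable.
\<close>
definition incomplete_beta :: "real \<Rightarrow> real \<Rightarrow> real" where
  "incomplete_beta b x = integral {0..x} (\<lambda>t. t powr (1/3 - 1) * (1 - t) powr (b - 1))"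

lemma incomplete_beta_0 [simp]: "incomplete_beta b 0 = 0"
  by (simp add: incomplete_beta_def)

lemma incomplete_beta_1: "b > 0 \<Longrightarrow> incomplete_beta b 1 = Beta (1/3) b"
  unfolding incomplete_beta_def by (intro integral_unique has_integral_Beta_real) auto

lemma continuous_on_incomplete_beta: "b > 0 \<Longrightarrow> continuous_on {0..1} (incomplete_beta b)"
  unfolding incomplete_beta_def [abs_def]
  by (intro indefinite_integral_continuous_1 integrable_Beta') auto

lemma incomplete_beta_has_field_derivative:
  assumes "b > 0" "0 < x" "x < 1"
  shows "(incomplete_beta b has_field_derivative x powr (-2/3) * (1 - x) powr (b - 1)) (at x)"
proof -
  let ?f = "\<lambda>t::real. t powr (1/3 - 1) * (1 - t) powr (b - 1)"
  have "continuous (at x within {0..1}) ?f"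
    using assms by (intro continuous_intros) auto
  hence "(incomplete_beta b has_vector_derivative ?f x) (at x within {0..1})"
    unfolding incomplete_beta_def [abs_def]
    using integral_has_vector_derivative_continuous_at[of ?f 0 1 x "{}"] assms integrable_Beta'[of "1/3" b]
    by simp
  moreover have "at x within {0..1} = at x"
    using assms by (intro at_within_interior) auto
  ultimately show ?thesis
    by (simp add: has_real_derivative_iff_has_vector_derivative)
qed

text \<open>
  The substitution \<open>t = y^3\<close>. The integrand is unbounded at \<open>y = 1\<close>, so the fundamental theorem is
  applied to the antiderivative, which is continuous on the closed interval.
\<close>
lemma pi3_eq_Beta: "pi3 = Beta (1/3) (1/3)"
proof -
  have "((\<lambda>y. 3 * (1 / (1 - y ^ 3) powr (2/3))) has_integral
      incomplete_beta (1/3) (1 ^ 3) - incomplete_beta (1/3) (0 ^ 3)) {0..1::real}"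
  proof (rule fundamental_theorem_of_calculus_interior)
    show "continuous_on {0..1} (\<lambda>y::real. incomplete_beta (1/3) (y ^ 3))"
      by (rule continuous_on_compose2[OF continuous_on_incomplete_beta])
         (auto intro!: continuous_intros power_le_one)
  next
    fix y :: real assume y: "y \<in> {0<..<1}"
    have y3: "0 < y ^ 3" "y ^ 3 < 1"
      using y by (auto simp: power_less_one_iff)
    have "((\<lambda>y. y ^ 3) has_field_derivative 3 * y\<^sup>2) (at y)"
      by (auto intro!: derivative_eq_intros)
    from DERIV_chain2[OF incomplete_beta_has_field_derivative[of "1/3", OF _ y3] this]
    have "((\<lambda>y. incomplete_beta (1/3) (y ^ 3)) has_field_derivative
        (y ^ 3) powr (-2/3) * (1 - y ^ 3) powr (-2/3) * (3 * y\<^sup>2)) (at y)"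
      by simp
    also have "(y ^ 3) powr (-2/3) * (1 - y ^ 3) powr (-2/3) * (3 * y\<^sup>2) =
        3 * (1 / (1 - y ^ 3) powr (2/3))"
      using y unfolding powr_neg_two_thirds[of "1 - y ^ 3"] by (subst cube_powr_neg_two_thirds) auto
    finally show "((\<lambda>y. incomplete_beta (1/3) (y ^ 3)) has_vector_derivative
        3 * (1 / (1 - y ^ 3) powr (2/3))) (at y)"
      by (simp add: has_real_derivative_iff_has_vector_derivative)
  qed auto
  from integral_unique[OF this]
  have "integral {0..1} (\<lambda>y::real. 3 * (1 / (1 - y ^ 3) powr (2/3))) = Beta (1/3) (1/3)"
    by (simp only: power_one) (simp add: incomplete_beta_1)
  thus ?thesis
    by (simp only: pi3_def integral_mult_right)
qed

text \<open>
  The elliptic integral of \<open>1 / (2 sqrt (1 + t^3))\<close> from 0 to \<open>x\<close>, that is, the time at which the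
  solution \<open>u\<close> of \<open>u' = 2 sqrt (u^3 + 1)\<close> with \<open>u(0) = 0\<close> takes the value \<open>x\<close>. It is written as an
  incomplete Beta integral with variable \<open>-x^3\<close> below 0 and \<open>x^3 / (1 + x^3)\<close> above: both variables
  run from 0 to 1, so that the endpoints -1 and infinity give complete Beta integrals.
\<close>
definition wp_time :: "real \<Rightarrow> real" where
  "wp_time x = (if x \<le> 0 then - incomplete_beta (1/2) (-(x ^ 3)) / 6
                else incomplete_beta (1/6) (x ^ 3 / (1 + x ^ 3)) / 6)"

lemma one_plus_cube_pos:
  assumes "x > -1"
  shows "1 + x ^ 3 > (0::real)"
proof -
  have "1 + x ^ 3 = (1 + x) * ((x - 1/2)\<^sup>2 + 3/4)"
    by (simp add: power2_eq_square power3_eq_cube algebra_simps)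
  also have "\<dots> > 0"
    using assms by (intro mult_pos_pos[OF _ add_nonneg_pos]) auto
  finally show ?thesis .
qed

lemma wp_time_minus_1: "wp_time (-1) = - Beta (1/3) (1/2) / 6"
  by (simp add: wp_time_def incomplete_beta_1)

lemma continuous_on_wp_time: "continuous_on {-1..} wp_time"
proof -
  have "continuous_on ({-1..0} \<union> {0..}) wp_time"
    unfolding wp_time_def [abs_def]
  proof (rule continuous_on_If)
    show "continuous_on {-1..0} (\<lambda>x::real. - incomplete_beta (1/2) (-(x ^ 3)) / 6)"
    proof (intro continuous_intros continuous_on_compose2[OF continuous_on_incomplete_beta])
      show "(\<lambda>x::real. -(x ^ 3)) ` {-1..0} \<subseteq> {0..1}"
        using power_mono_odd[of 3 "-1 :: real"] power_mono_odd[of 3 _ "0 :: real"] by force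
    qed auto
    show "continuous_on {0..} (\<lambda>x::real. incomplete_beta (1/6) (x ^ 3 / (1 + x ^ 3)) / 6)"
    proof (intro continuous_intros continuous_on_compose2[OF continuous_on_incomplete_beta] ballI)
      show "1 + x ^ 3 \<noteq> 0" if "x \<in> {0..}" for x :: real
        using one_plus_cube_pos[of x] that by auto
      show "(\<lambda>x::real. x ^ 3 / (1 + x ^ 3)) ` {0..} \<subseteq> {0..1}"
        by (auto simp: divide_le_eq_1 add_pos_nonneg)
    qed auto
  qed (auto intro!: antisym)
  moreover have "{-1..0} \<union> {0..} = {-1::real..}"
    by auto
  ultimately show ?thesis by simp
qed

text \<open>
  The point 0 is left out because both formulas have a singular integrand there; the continuity of
  \<open>wp_time\<close> makes up for it later.
\<close>
lemma wp_time_has_field_derivative: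
  assumes x: "x > -1" "x \<noteq> 0"
  shows "(wp_time has_field_derivative 1 / (2 * sqrt (1 + x ^ 3))) (at x)"
proof (cases "x < 0")
  case True
  have x3: "0 < -(x ^ 3)" "-(x ^ 3) < 1"
    using one_plus_cube_pos[OF x(1)] True by (auto simp: power_less_zero_eq)
  have d: "((\<lambda>x. -(x ^ 3)) has_field_derivative -(3 * x\<^sup>2)) (at x)"
    by (auto intro!: derivative_eq_intros)
  have "((\<lambda>x. incomplete_beta (1/2) (-(x ^ 3))) has_field_derivative
      (-(x ^ 3)) powr (-2/3) * (1 + x ^ 3) powr (-1/2) * -(3 * x\<^sup>2)) (at x)"
    using DERIV_chain2[where f = "incomplete_beta (1/2)" and g = "\<lambda>x. -(x ^ 3)" and x = x,
        OF incomplete_beta_has_field_derivative[of "1/2", OF _ x3] d] by simp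
  from DERIV_cdivide[OF DERIV_minus[OF this], of 6]
  have "((\<lambda>x. - incomplete_beta (1/2) (-(x ^ 3)) / 6) has_field_derivative
      - ((-(x ^ 3)) powr (-2/3) * (1 + x ^ 3) powr (-1/2) * -(3 * x\<^sup>2)) / 6) (at x)"
    by simp
  also have "- ((-(x ^ 3)) powr (-2/3) * (1 + x ^ 3) powr (-1/2) * -(3 * x\<^sup>2)) / 6 =
      (1 + x ^ 3) powr (-1/2) / 2"
    using cube_powr_neg_two_thirds[of "-x"] True by simp
  also have "(1 + x ^ 3) powr (-1/2) = 1 / sqrt (1 + x ^ 3)"
    using one_plus_cube_pos[OF x(1)]
    by (simp only: minus_divide_left[symmetric] powr_minus powr_half_sqrt inverse_eq_divide less_imp_le)
  also have "1 / sqrt (1 + x ^ 3) / 2 = 1 / (2 * sqrt (1 + x ^ 3))"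
    by simp
  finally have "((\<lambda>x. - incomplete_beta (1/2) (-(x ^ 3)) / 6) has_field_derivative
      1 / (2 * sqrt (1 + x ^ 3))) (at x)" .
  thus ?thesis
  proof (rule has_field_derivative_transform_within_open)
    show "open {..<0::real}" "x \<in> {..<0}" using True by auto
  qed (auto simp: wp_time_def)
next
  case False
  with x have pos: "x > 0" by simp
  define u where "u = 1 + x ^ 3"
  have u: "u > 1" using pos by (simp add: u_def)
  have v: "0 < x ^ 3 / u" "x ^ 3 / u < 1"
    using pos u by (simp_all, simp add: u_def)
  have "((\<lambda>x. x ^ 3 / (1 + x ^ 3)) has_field_derivative (3 * x\<^sup>2 * u - x ^ 3 * (3 * x\<^sup>2)) / (u * u)) (at x)"
    using one_plus_cube_pos[OF x(1)] unfolding u_def by (auto intro!: derivative_eq_intros)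
  also have "3 * x\<^sup>2 * u - x ^ 3 * (3 * x\<^sup>2) = 3 * x\<^sup>2"
    by (simp add: u_def algebra_simps)
  finally have "((\<lambda>x. x ^ 3 / (1 + x ^ 3)) has_field_derivative 3 * x\<^sup>2 / (u * u)) (at x)" .
  from DERIV_cdivide[OF DERIV_chain2[OF incomplete_beta_has_field_derivative[of "1/6", OF _ v[unfolded u_def]] this], of 6]
  have "((\<lambda>x. incomplete_beta (1/6) (x ^ 3 / (1 + x ^ 3)) / 6) has_field_derivative
      ((x ^ 3 / u) powr (-2/3) * (1 - x ^ 3 / u) powr (-5/6) * (3 * x\<^sup>2 / (u * u))) / 6) (at x)"
    by (simp add: u_def)
  also have "((x ^ 3 / u) powr (-2/3) * (1 - x ^ 3 / u) powr (-5/6) * (3 * x\<^sup>2 / (u * u))) / 6 =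
      1 / (2 * sqrt u)"
  proof -
    have "1 - x ^ 3 / u = (u - x ^ 3) / u"
      using u by (simp add: diff_divide_distrib)
    also have "u - x ^ 3 = 1"
      by (simp add: u_def)
    also have "1 / u = u powr (-1)"
      using u by (simp add: powr_minus_divide)
    finally have "(1 - x ^ 3 / u) powr (-5/6) = (u powr (-1)) powr (-5/6)"
      by simp
    also have "\<dots> = u powr (5/6)"
      by (subst powr_powr) simp
    finally have 1: "(1 - x ^ 3 / u) powr (-5/6) = u powr (5/6)" .
    have "(x ^ 3 / u) powr (-2/3) = (x ^ 3) powr (-2/3) / u powr (-2/3)"
      by (rule powr_divide)
    hence 2: "(x ^ 3 / u) powr (-2/3) = 1 / x\<^sup>2 * u powr (2/3)"
      by (simp only: cube_powr_neg_two_thirds[OF pos] powr_neg_two_thirds[of u]) simp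
    have "u powr (2/3) * u powr (5/6) = u powr (1 + 1/2)"
      by (simp flip: powr_add)
    also have "\<dots> = u * sqrt u"
      using u by (simp only: powr_add powr_half_sqrt less_imp_le powr_one)
    finally have 3: "u powr (2/3) * u powr (5/6) = u * sqrt u" .
    have "1 / x\<^sup>2 * u powr (2/3) * u powr (5/6) * (3 * x\<^sup>2 / (u * u)) / 6
        = (u powr (2/3) * u powr (5/6)) / (2 * (u * u))"
      using pos by simp
    also have "\<dots> = sqrt u / (2 * (sqrt u * sqrt u))"
      unfolding 3 using u by simp
    also have "\<dots> = 1 / (2 * sqrt u)"
      using u by (simp only: mult.assoc[symmetric]) simp
    finally show ?thesis
      unfolding 1 2 .
  qed
  finally have "((\<lambda>x. incomplete_beta (1/6) (x ^ 3 / (1 + x ^ 3)) / 6) has_field_derivative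
      1 / (2 * sqrt (1 + x ^ 3))) (at x)"
    by (simp add: u_def)
  thus ?thesis
  proof (rule has_field_derivative_transform_within_open)
    show "open {0::real<..}" "x \<in> {0<..}" using pos by auto
  qed (auto simp: wp_time_def)
qed

lemma tendsto_wp_time_at_top: "(wp_time \<longlongrightarrow> Beta (1/3) (1/6) / 6) at_top"
proof -
  have "((\<lambda>x::real. x ^ 3 / (1 + x ^ 3)) \<longlongrightarrow> 1) at_top"
    by real_asymp
  moreover have "eventually (\<lambda>x::real. x ^ 3 / (1 + x ^ 3) \<in> {0..1}) at_top"
    using eventually_ge_at_top[of 0]
    by eventually_elim (auto simp: divide_le_eq_1 add_pos_nonneg)
  ultimately have "((\<lambda>x. incomplete_beta (1/6) (x ^ 3 / (1 + x ^ 3))) \<longlongrightarrow> incomplete_beta (1/6) 1) at_top"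
    by (intro continuous_on_tendsto_compose[OF continuous_on_incomplete_beta]) auto
  hence "((\<lambda>x. incomplete_beta (1/6) (x ^ 3 / (1 + x ^ 3)) / 6) \<longlongrightarrow> Beta (1/3) (1/6) / 6) at_top"
    by (intro tendsto_intros) (simp_all add: incomplete_beta_1)
  moreover have "eventually (\<lambda>x. incomplete_beta (1/6) (x ^ 3 / (1 + x ^ 3)) / 6 = wp_time x) at_top"
    using eventually_gt_at_top[of 0] by eventually_elim (simp add: wp_time_def)
  ultimately show ?thesis
    by (rule Lim_transform_eventually)
qed

section \<open>The first real pole\<close>

lemma wp_time_bounded_above: obtains M where "\<And>x. x \<ge> -1 \<Longrightarrow> wp_time x \<le> M"
proof -
  have "bounded (wp_time ` {-1..0})"
    by (rule compact_imp_bounded[OF compact_continuous_image[OF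
          continuous_on_subset[OF continuous_on_wp_time]]]) auto
  from bounded_imp_bdd_above[OF this] obtain A
    where A: "\<And>x. x \<in> {-1..0} \<Longrightarrow> wp_time x \<le> A"
    by (metis bdd_above.E image_eqI)
  have "bounded (incomplete_beta (1/6) ` {0..1})"
    by (rule compact_imp_bounded[OF compact_continuous_image[OF continuous_on_incomplete_beta]]) auto
  from bounded_imp_bdd_above[OF this] obtain B
    where B: "\<And>x. x \<in> {0..1} \<Longrightarrow> incomplete_beta (1/6) x \<le> B"
    by (metis bdd_above.E image_eqI)
  have "wp_time x \<le> max A (B / 6)" if "x \<ge> -1" for x
  proof (cases "x \<le> 0")
    case True
    thus ?thesis using A[of x] that by simp
  next
    case False
    hence "x ^ 3 / (1 + x ^ 3) \<in> {0..1}"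
      by (auto simp: divide_le_eq_1 add_pos_nonneg)
    from B[OF this] False show ?thesis
      by (simp add: wp_time_def)
  qed
  thus thesis by (rule that)
qed

text \<open>
  A function that commutes with conjugation is real on the real line, and so is its derivative.
\<close>
lemma real_line_derivative:
  fixes p :: "complex \<Rightarrow> complex" and x :: real
  assumes an: "p analytic_on {of_real x}" and cnj: "\<And>z. p (cnj z) = cnj (p z)"
  shows "((\<lambda>x. Re (p (of_real x))) has_real_derivative Re (deriv p (of_real x))) (at x)"
    and "deriv p (of_real x) = of_real (Re (deriv p (of_real x)))"
proof -
  have "(p has_field_derivative deriv p (of_real x)) (at (of_real x))"
    using an by (simp add: analytic_on_imp_differentiable_at DERIV_deriv_iff_field_differentiable)
  hence vd: "((\<lambda>x. p (of_real x)) has_vector_derivative deriv p (of_real x)) (at x)"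
    by (rule has_vector_derivative_real_field)
  show "((\<lambda>x. Re (p (of_real x))) has_real_derivative Re (deriv p (of_real x))) (at x)"
    unfolding has_real_derivative_iff_has_vector_derivative
    by (rule bounded_linear.has_vector_derivative[OF bounded_linear_Re vd])
  have "((\<lambda>x. Im (p (of_real x))) has_vector_derivative Im (deriv p (of_real x))) (at x)"
    by (rule bounded_linear.has_vector_derivative[OF bounded_linear_Im vd])
  moreover have "Im (p (of_real x)) = 0" for x
    using cnj[of "of_real x"] by (simp add: complex_eq_iff)
  ultimately have "((\<lambda>x. 0) has_vector_derivative Im (deriv p (of_real x))) (at x)"
    by simp
  hence "Im (deriv p (of_real x)) = 0"
    using vector_derivative_unique_at[OF _ has_vector_derivative_const] by blast
  thus "deriv p (of_real x) = of_real (Re (deriv p (of_real x)))"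
    by (simp add: complex_eq_iff)
qed

lemma tendsto_of_real_at: "filterlim (of_real :: real \<Rightarrow> complex) (at (of_real x)) (at x)"
  unfolding filterlim_at
proof
  show "(of_real \<longlongrightarrow> complex_of_real x) (at x)"
    by (intro tendsto_intros)
  show "eventually (\<lambda>y. complex_of_real y \<in> UNIV \<and> complex_of_real y \<noteq> of_real x) (at x)"
    by (simp add: eventually_at_filter)
qed

text \<open>
  By the differential equation \<open>wp_time (u t) - t\<close> has derivative 0. The function \<open>u\<close> is strictly
  increasing, so the value 0, at which \<open>wp_time\<close> is not known to be differentiable, is taken at most
  once.
\<close>
lemma wp_time_along_solution:
  fixes u u' :: "real \<Rightarrow> real"
  assumes b: "0 < b" and cont: "continuous_on {0..<b} u" and u0: "u 0 = -1"
    and der: "\<And>t. 0 < t \<Longrightarrow> t < b \<Longrightarrow> (u has_real_derivative u' t) (at t)"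
    and pos: "\<And>t. 0 < t \<Longrightarrow> t < b \<Longrightarrow> u' t > 0"
    and ode: "\<And>t. 0 < t \<Longrightarrow> t < b \<Longrightarrow> (u' t)\<^sup>2 = 4 * u t ^ 3 + 4"
    and x: "0 < x" "x < b"
  shows "u x > -1" and "wp_time (u x) = wp_time (-1) + x"
proof -
  have mono: "u s < u t" if "0 \<le> s" "s < t" "t < b" for s t
  proof (rule DERIV_pos_imp_increasing_open[OF that(2)])
    show "\<exists>y. (u has_real_derivative y) (at r) \<and> 0 < y" if "s < r" "r < t" for r
      using der[of r] pos[of r] that \<open>0 \<le> s\<close> \<open>t < b\<close> by auto
    show "continuous_on {s..t} u"
      by (rule continuous_on_subset[OF cont]) (use that in auto)
  qed
  have gt: "u t > -1" if "0 < t" "t < b" for t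
    using mono[of 0 t] that u0 by simp
  show "u x > -1"
    using gt x by simp
  \<comment> \<open>The exceptional points: the start, where \<open>u\<close> is -1 and \<open>wp_time\<close> has an infinite slope, and the
    zero of \<open>u\<close>.\<close>
  define k where "k = {0} \<union> {t \<in> {0..x}. u t = 0}"
  have "k \<subseteq> {0, THE t. t \<in> {0..x} \<and> u t = 0}"
  proof
    fix t assume t: "t \<in> k"
    show "t \<in> {0, THE t. t \<in> {0..x} \<and> u t = 0}"
    proof (cases "t = 0")
      case False
      have "(THE t. t \<in> {0..x} \<and> u t = 0) = t"
      proof (rule the_equality)
        fix s assume s: "s \<in> {0..x} \<and> u s = 0"
        show "s = t"
          using mono[of s t] mono[of t s] s t False x by (cases s t rule: linorder_cases) (auto simp: k_def)
      qed (use t False in \<open>auto simp: k_def\<close>)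
      thus ?thesis by simp
    qed simp
  qed
  hence fin: "finite k"
    by (rule finite_subset) simp
  have "wp_time (u x) - x = wp_time (-1)"
  proof (rule has_derivative_zero_unique_strong_interval[OF fin, of 0 x "\<lambda>t. wp_time (u t) - t"])
    show "continuous_on {0..x} (\<lambda>t. wp_time (u t) - t)"
    proof (intro continuous_intros continuous_on_compose2[OF continuous_on_wp_time])
      show "continuous_on {0..x} u"
        by (rule continuous_on_subset[OF cont]) (use x in auto)
      show "u ` {0..x} \<subseteq> {-1..}"
      proof safe
        fix t assume "t \<in> {0..x}"
        thus "u t \<ge> -1"
          using gt[of t] u0 x by (cases "t = 0") auto
      qed
    qed
    show "wp_time (u 0) - 0 = wp_time (-1)"
      by (simp add: u0)
    show "x \<in> {0..x}"
      using x by simp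
  next
    fix t assume t: "t \<in> {0..x} - k"
    hence t': "0 < t" "t < b" "u t \<noteq> 0"
      using x by (auto simp: k_def)
    have "1 + u t ^ 3 > 0"
      by (rule one_plus_cube_pos) (use gt t' in auto)
    moreover have "(u' t)\<^sup>2 = (2 * sqrt (1 + u t ^ 3))\<^sup>2"
      using ode[OF t'(1,2)] calculation by (simp add: power_mult_distrib)
    ultimately have nz: "sqrt (1 + u t ^ 3) \<noteq> 0" and u': "u' t = 2 * sqrt (1 + u t ^ 3)"
      using pos[OF t'(1,2)] by (simp, intro power2_eq_imp_eq[of "u' t"]) simp_all
    have "((\<lambda>t. wp_time (u t) - t) has_real_derivative
        1 / (2 * sqrt (1 + u t ^ 3)) * u' t - 1) (at t)"
      by (intro DERIV_diff DERIV_chain2[OF wp_time_has_field_derivative der] DERIV_ident)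
         (use gt[of t] t' in auto)
    hence "((\<lambda>t. wp_time (u t) - t) has_real_derivative 0) (at t)"
      using nz by (simp add: u')
    hence "((\<lambda>t. wp_time (u t) - t) has_real_derivative 0) (at t within {0..x})"
      by (rule has_field_derivative_at_within)
    thus "((\<lambda>t. wp_time (u t) - t) has_derivative (\<lambda>h. 0)) (at t within {0..x})"
      by (simp add: has_field_derivative_def lambda_zero)
  qed
  thus "wp_time (u x) = wp_time (-1) + x"
    by simp
qed

text \<open>
  Follow \<open>p\<close> along the positive real axis as long as it has no pole and increases. This cannot go on
  forever, since the elapsed time is a value of the bounded function \<open>wp_time\<close>. At the first
  obstruction \<open>p\<close> has a pole: otherwise \<open>p' = 2 sqrt (p^3 + 1)\<close> would still be positive there. At the
  pole \<open>p\<close> tends to infinity, and the elapsed time is the complete integral.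
\<close>
lemma wp_shifted_first_pole:
  assumes sol: "wp_solution p"
    and cnj: "\<And>z. p (cnj z) = cnj (p z)"
    and an0: "p analytic_on {0}" and p0: "p 0 = -1" and p0': "(\<lambda>w. deriv p w / w) \<midarrow>0\<rightarrow> 6"
  defines "s \<equiv> Beta (1/3) (1/2) / 2"
  shows "is_pole p (of_real s)" and "\<And>t. 0 \<le> t \<Longrightarrow> t < s \<Longrightarrow> \<not> is_pole p (of_real t)"
proof -
  define u u' where "u x = Re (p (of_real x))" and "u' x = Re (deriv p (of_real x))" for x
  have an: "p analytic_on {z}" and ode: "wp_ode p z" if "\<not> is_pole p z" for z
    using sol that wp_solution_analytic by (auto simp: wp_solution_def)
  have p_u: "p (of_real x) = of_real (u x)" for x
    using cnj[of "of_real x"] by (simp add: u_def complex_eq_iff)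
  have der: "(u has_real_derivative u' x) (at x)" and der_eq: "deriv p (of_real x) = of_real (u' x)"
    if "\<not> is_pole p (of_real x)" for x
    using real_line_derivative[OF an[OF that] cnj] by (simp_all add: u_def [abs_def] u'_def [abs_def])
  have u_ode: "(u' x)\<^sup>2 = 4 * u x ^ 3 + 4" if "\<not> is_pole p (of_real x)" for x
  proof -
    have "complex_of_real ((u' x)\<^sup>2) = of_real (4 * u x ^ 3 + 4)"
      using ode[OF that] by (simp add: wp_ode_def der_eq[OF that] p_u)
    thus ?thesis by (simp only: of_real_eq_iff)
  qed
  have no_pole_0: "\<not> is_pole p 0"
    using an0 by (rule analytic_at_imp_no_pole)
  \<comment> \<open>The times up to which \<open>p\<close> increases without meeting a pole; the supremum turns out to be the first pole.\<close>
  define B where "B = {b. 0 < b \<and> (\<forall>t. 0 < t \<and> t < b \<longrightarrow> \<not> is_pole p (of_real t) \<and> u' t > 0)}"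
  have B_ne: "\<exists>e. e \<in> B"
  proof -
    have "eventually (\<lambda>w. dist (deriv p w / w) 6 < 6) (at 0)"
      using p0' by (rule tendstoD) simp
    moreover have "eventually (\<lambda>w. \<not> is_pole p w) (at 0)"
      using eventually_nhds_imp_at[OF eventually_analytic_at[OF an0]]
      by eventually_elim (rule analytic_at_imp_no_pole)
    ultimately have "eventually (\<lambda>w. dist (deriv p w / w) 6 < 6 \<and> \<not> is_pole p w) (at 0)"
      by (rule eventually_conj)
    then obtain e where e: "e > 0"
      "\<And>w. w \<noteq> 0 \<Longrightarrow> dist w 0 < e \<Longrightarrow> dist (deriv p w / w) 6 < 6 \<and> \<not> is_pole p w"
      by (auto simp: eventually_at)
    have "\<not> is_pole p (of_real t) \<and> u' t > 0" if t: "0 < t" "t < e" for t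
    proof
      show np: "\<not> is_pole p (of_real t)"
        using e(2)[of "of_real t"] t by simp
      have "dist (complex_of_real (u' t / t)) (of_real 6) < 6"
        using e(2)[of "of_real t"] t der_eq[OF np] by simp
      hence "\<bar>u' t / t - 6\<bar> < 6"
        by (simp only: dist_of_real dist_real_def)
      hence "u' t / t > 0" by linarith
      thus "u' t > 0" using t by (simp add: zero_less_divide_iff)
    qed
    thus ?thesis
      using e(1) by (auto simp: B_def)
  qed
  have cont: "continuous_on {0..<b} u" if "b \<in> B" for b
  proof (rule DERIV_continuous_on)
    fix t assume "t \<in> {0..<b}"
    hence "\<not> is_pole p (of_real t)"
      using that no_pole_0 by (cases "t = 0") (auto simp: B_def)
    thus "(u has_real_derivative u' t) (at t within {0..<b})"
      by (rule has_field_derivative_at_within[OF der])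
  qed
  have along: "u x > -1" "wp_time (u x) = wp_time (-1) + x" if "b \<in> B" "0 < x" "x < b" for b x
  proof -
    have N: "0 < b" "\<And>t. 0 < t \<Longrightarrow> t < b \<Longrightarrow> \<not> is_pole p (of_real t)"
        "\<And>t. 0 < t \<Longrightarrow> t < b \<Longrightarrow> u' t > 0"
      using that(1) by (simp_all add: B_def)
    have u0: "u 0 = -1"
      by (simp add: u_def p0)
    note rules = wp_time_along_solution[of b u u' x, OF N(1) cont[OF that(1)] u0 _ _ _ that(2,3)]
    show "u x > -1"
      by (rule rules(1)) (assumption | rule der u_ode N)+
    show "wp_time (u x) = wp_time (-1) + x"
      by (rule rules(2)) (assumption | rule der u_ode N)+
  qed
  obtain M where M: "\<And>x. x \<ge> -1 \<Longrightarrow> wp_time x \<le> M"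
    using wp_time_bounded_above by blast
  have B_bdd: "bdd_above B"
  proof (rule bdd_aboveI)
    fix b assume b: "b \<in> B"
    hence "b > 0" by (simp add: B_def)
    thus "b \<le> 2 * (M - wp_time (-1))"
      using along[OF b, of "b / 2"] M[of "u (b / 2)"] by simp
  qed
  define c where "c = Sup B"
  have c_pos: "c > 0"
    using B_ne cSup_upper[OF _ B_bdd] by (force simp: B_def c_def)
  have c_B: "c \<in> B"
    unfolding B_def
  proof safe
    fix t assume "0 < t" "t < c"
    then obtain b where "b \<in> B" "t < b"
      using less_cSup_iff[OF _ B_bdd, of t] B_ne by (auto simp: c_def)
    thus "is_pole p (of_real t) \<Longrightarrow> False" "u' t > 0"
      using \<open>0 < t\<close> by (auto simp: B_def)
  qed (rule c_pos)
  note sol_c = along[OF c_B]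
  have no_pole: "\<not> is_pole p (of_real t)" if "0 \<le> t" "t < c" for t
    using c_B that no_pole_0 by (cases "t = 0") (auto simp: B_def)
  have left: "eventually (\<lambda>t. 0 < t \<and> t < c) (at_left c)"
    using c_pos by (auto simp: eventually_at_left)
  have pole: "is_pole p (of_real c)"
  proof (rule ccontr)
    assume np: "\<not> is_pole p (of_real c)"
    have "continuous_on {0..c} u"
    proof (rule DERIV_continuous_on)
      fix t assume "t \<in> {0..c}"
      hence "\<not> is_pole p (of_real t)"
        using no_pole[of t] np by (cases "t = c") auto
      thus "(u has_real_derivative u' t) (at t within {0..c})"
        by (rule has_field_derivative_at_within[OF der])
    qed
    hence "continuous_on {c / 2..c} u"
      by (rule continuous_on_subset) (use c_pos in auto)
    moreover have "\<exists>y. (u has_real_derivative y) (at t) \<and> 0 < y" if "c / 2 < t" "t < c" for t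
      using c_B that c_pos der[of t] no_pole[of t] by (auto simp: B_def)
    ultimately have "u (c / 2) < u c"
      using c_pos by (intro DERIV_pos_imp_increasing_open[of "c / 2" c u]) auto
    moreover have "u (c / 2) > -1"
      using sol_c(1)[of "c / 2"] c_pos by simp
    ultimately have "1 + u c ^ 3 > 0"
      by (intro one_plus_cube_pos) simp
    hence nz: "u' c \<noteq> 0"
      using u_ode[OF np] by auto
    have an_c: "deriv p analytic_on {of_real c}"
      using an[OF np] by (rule analytic_deriv)
    have "((\<lambda>t. deriv p (of_real t)) \<longlongrightarrow> deriv p (of_real c)) (at c)"
      by (rule filterlim_compose[OF isContD[OF analytic_at_imp_isCont[OF an_c]] tendsto_of_real_at])
    hence lim: "(u' \<longlongrightarrow> u' c) (at c)"
      unfolding u'_def [abs_def] by (rule tendsto_Re)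
    hence "(u' \<longlongrightarrow> u' c) (at_left c)"
      by (rule tendsto_within_subset) simp
    moreover have "eventually (\<lambda>t. u' t \<ge> 0) (at_left c)"
      using left by eventually_elim (use c_B in \<open>auto simp: B_def less_imp_le\<close>)
    ultimately have "u' c \<ge> 0"
      by (rule tendsto_lowerbound) simp
    with nz have pos: "u' c > 0" by simp
    have "eventually (\<lambda>t. u' t > 0) (at c)"
      using order_tendstoD(1)[OF lim pos] .
    moreover have "eventually (\<lambda>t. \<not> is_pole p (of_real t)) (at c)"
    proof (rule eventually_compose_filterlim[OF _ tendsto_of_real_at])
      show "eventually (\<lambda>w. \<not> is_pole p w) (at (of_real c))"
        using eventually_nhds_imp_at[OF eventually_analytic_at[OF an[OF np]]]
        by eventually_elim (rule analytic_at_imp_no_pole)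
    qed
    ultimately have "eventually (\<lambda>t. u' t > 0 \<and> \<not> is_pole p (of_real t)) (at c)"
      by (rule eventually_conj)
    then obtain e where e: "e > 0"
      "\<And>t. t \<noteq> c \<Longrightarrow> dist t c < e \<Longrightarrow> u' t > 0 \<and> \<not> is_pole p (of_real t)"
      by (auto simp: eventually_at)
    have "c + e \<in> B"
      unfolding B_def
    proof (intro CollectI conjI allI impI)
      fix t assume t: "0 < t \<and> t < c + e"
      show "\<not> is_pole p (of_real t)" "u' t > 0"
      proof (atomize (full), cases t c rule: linorder_cases)
        case less
        thus "\<not> is_pole p (of_real t) \<and> u' t > 0"
          using c_B t by (simp add: B_def)
      next
        case equal
        thus "\<not> is_pole p (of_real t) \<and> u' t > 0"
          using np pos by simp
      next
        case greater
        thus "\<not> is_pole p (of_real t) \<and> u' t > 0"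
          using e(2)[of t] t by (simp add: dist_real_def)
      qed
    qed (use c_pos e(1) in simp)
    from cSup_upper[OF this B_bdd] e(1) show False
      by (simp add: c_def)
  qed
  have "filterlim (\<lambda>t. p (of_real t)) at_infinity (at_left c)"
    by (rule filterlim_compose[OF pole[unfolded is_pole_def]],
        rule filterlim_mono[OF tendsto_of_real_at order.refl at_le]) simp
  hence "filterlim (\<lambda>t. norm (p (of_real t))) at_top (at_left c)"
    by (rule filterlim_at_infinity_imp_norm_at_top)
  hence abs_top: "filterlim (\<lambda>t. \<bar>u t\<bar>) at_top (at_left c)"
    by (simp add: p_u)
  have "eventually (\<lambda>t. \<bar>u t\<bar> > 1) (at_left c)"
    using abs_top unfolding filterlim_at_top_dense by blast
  with left have "eventually (\<lambda>t. \<bar>u t\<bar> = u t) (at_left c)"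
  proof eventually_elim
    case (elim t)
    thus ?case
      using sol_c(1)[of t] by linarith
  qed
  with abs_top have "filterlim u at_top (at_left c)"
    using filterlim_cong[OF refl refl, of "\<lambda>t. \<bar>u t\<bar>" u] by blast
  from filterlim_compose[OF tendsto_wp_time_at_top this]
  have "((\<lambda>t. wp_time (u t)) \<longlongrightarrow> Beta (1/3) (1/6) / 6) (at_left c)" .
  moreover have "eventually (\<lambda>t. wp_time (u t) = wp_time (-1) + t) (at_left c)"
    using left by eventually_elim (use sol_c(2) in auto)
  ultimately have "((\<lambda>t. wp_time (-1) + t) \<longlongrightarrow> Beta (1/3) (1/6) / 6) (at_left c)"
    by (rule Lim_transform_eventually)
  moreover have "((\<lambda>t. wp_time (-1) + t) \<longlongrightarrow> wp_time (-1) + c) (at_left c)"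
    by (intro tendsto_intros)
  ultimately have "wp_time (-1) + c = Beta (1/3) (1/6) / 6"
    using tendsto_unique[OF trivial_limit_at_left_real] by blast
  hence "c = s"
    by (simp add: wp_time_minus_1 Beta_third_sixth s_def)
  thus "is_pole p (of_real s)" "\<And>t. 0 \<le> t \<Longrightarrow> t < s \<Longrightarrow> \<not> is_pole p (of_real t)"
    using pole no_pole by auto
qed

section \<open>The Weierstrass function and its periods\<close>

lemma wp_solution_unique:
  assumes "wp_solution P" "wp_solution Q" "(\<lambda>z. z\<^sup>2 * P z) \<midarrow>0\<rightarrow> 1" "(\<lambda>z. z\<^sup>2 * Q z) \<midarrow>0\<rightarrow> 1"
  shows "P = Q"
proof (rule nicely_meromorphic_eq_if_eq_near)
  show "eventually (\<lambda>z. P z = Q z) (at 0)"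
    by (rule wp_ode_unique_pole) (use assms wp_solution_meromorphic wp_solution_eventually_ode in auto)
qed (use assms in \<open>simp_all add: wp_solution_def\<close>)

text \<open>
  If \<open>n\<close> is the order at 0, then \<open>z P'/P\<close> tends to \<open>n\<close>, and the differential equation divided by
  \<open>P^2\<close> shows that \<open>z^2 P\<close> tends to \<open>n^2 / 4\<close>. As \<open>n\<close> is not zero, the order is -2.
\<close>
lemma wp_solution_pole:
  assumes P: "wp_solution P" and pole: "is_pole P 0"
  shows "(\<lambda>z. z\<^sup>2 * P z) \<midarrow>0\<rightarrow> 1"
proof -
  have mero: "P meromorphic_on {0}"
    by (rule wp_solution_meromorphic[OF P])
  have P_inf: "filterlim P at_infinity (at 0)"
    using pole by (simp add: is_pole_def)
  have nz: "eventually (\<lambda>z. P z \<noteq> 0) (at 0)"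
    using pole by (rule non_zero_neighbour_pole)
  have "frequently (\<lambda>z. P z \<noteq> 0) (at 0)"
    by (rule eventually_frequently[OF at_neq_bot nz])
  moreover have "isolated_singularity_at P 0" "not_essential P 0"
    using mero by (simp_all add: meromorphic_at_iff)
  ultimately obtain n g r where g: "g 0 \<noteq> 0" "r > 0" "g holomorphic_on cball 0 r"
      "\<And>w. w \<in> cball 0 r - {0} \<Longrightarrow> P w = g w * w powi n \<and> g w \<noteq> 0"
    using zorder_exist[of P 0] by auto
  have g': "g holomorphic_on ball 0 r"
    using g(3) ball_subset_cball holomorphic_on_subset by blast
  have P_eq: "P w = g w * w powi n" if "w \<in> ball 0 r - {0}" for w
  proof -
    have "w \<in> cball 0 r - {0}"
      using that by auto
    from g(4)[OF this] show ?thesis ..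
  qed
  have n: "n \<noteq> 0"
  proof
    assume "n = 0"
    have "g \<midarrow>0\<rightarrow> g 0"
      using g' g(2) by (metis centre_in_ball continuous_on_interior holomorphic_on_imp_continuous_on
          interior_ball isContD)
    moreover have "eventually (\<lambda>w. w \<in> ball 0 r - {0}) (at (0::complex))"
      using g(2) by (intro eventually_at_in_open) auto
    hence "eventually (\<lambda>w. g w = P w) (at 0)"
    proof eventually_elim
      case (elim w)
      from P_eq[OF this] show ?case
        by (simp add: \<open>n = 0\<close>)
    qed
    ultimately have "P \<midarrow>0\<rightarrow> g 0"
      by (rule Lim_transform_eventually)
    thus False
      using P_inf not_tendsto_and_filterlim_at_infinity[OF at_neq_bot] by blast
  qed
  have log_deriv: "(\<lambda>z. z * deriv P z / P z) \<midarrow>0\<rightarrow> complex_of_int n"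
    by (rule tendsto_log_deriv[OF P_eq g' g(1,2)])
  have inv: "(\<lambda>z. inverse (P z)) \<midarrow>0\<rightarrow> 0"
    using P_inf by (rule filterlim_compose[OF tendsto_inverse_0])
  have "(\<lambda>z. ((z * deriv P z / P z)\<^sup>2 - 4 * z\<^sup>2 * (inverse (P z))\<^sup>2) / 4) \<midarrow>0\<rightarrow>
      ((of_int n)\<^sup>2 - 4 * 0\<^sup>2 * 0\<^sup>2) / 4"
    by (rule tendsto_divide[OF tendsto_diff[OF tendsto_power[OF log_deriv] tendsto_mult[OF
        tendsto_mult[OF tendsto_const tendsto_power[OF tendsto_ident_at]] tendsto_power[OF inv]]]
        tendsto_const]) simp
  moreover have "eventually (\<lambda>z. ((z * deriv P z / P z)\<^sup>2 - 4 * z\<^sup>2 * (inverse (P z))\<^sup>2) / 4 = z\<^sup>2 * P z) (at 0)"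
    using nz wp_solution_eventually_ode[OF P, of 0]
  proof eventually_elim
    case (elim z)
    have "(z * deriv P z / P z)\<^sup>2 = z\<^sup>2 * (4 * P z ^ 3 + 4) * (inverse (P z))\<^sup>2"
      using elim(2) by (simp only: divide_inverse power_mult_distrib wp_ode_def)
    also have "\<dots> = 4 * (z\<^sup>2 * P z) + 4 * z\<^sup>2 * (inverse (P z))\<^sup>2"
      using left_inverse[OF elim(1)] by algebra
    finally show ?case by simp
  qed
  ultimately have lim: "(\<lambda>z. z\<^sup>2 * P z) \<midarrow>0\<rightarrow> ((of_int n)\<^sup>2 - 4 * 0\<^sup>2 * 0\<^sup>2) / 4"
    by (rule Lim_transform_eventually)
  hence lim: "(\<lambda>z. z\<^sup>2 * P z) \<midarrow>0\<rightarrow> (of_int n)\<^sup>2 / 4"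
    by simp
  moreover have "(\<lambda>z. z\<^sup>2 * P z) = (\<lambda>z. P z / z powi (-2))"
    by (simp add: fun_eq_iff power_int_minus divide_inverse mult.commute)
  ultimately have "(\<lambda>z. P z / z powi (-2)) \<midarrow>0\<rightarrow> (of_int n)\<^sup>2 / 4"
    by (simp only:)
  moreover have "(of_int n)\<^sup>2 / 4 \<noteq> (0::complex)"
    using n by simp
  ultimately have "(\<lambda>z. z * deriv P z / P z) \<midarrow>0\<rightarrow> complex_of_int (-2)"
    by (rule tendsto_log_deriv'[OF mero])
  from LIM_unique[OF log_deriv this] have "n = -2"
    by (simp only: of_int_eq_iff)
  hence "(of_int n)\<^sup>2 / 4 = (1::complex)"
    by simp
  with lim show ?thesis
    by (simp only:)
qed

lemma nonreal_cube_root_of_unity: obtains w :: complex where "w ^ 3 = 1" "Im w \<noteq> 0"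
proof
  show "(cis (2 * pi / 3)) ^ 3 = 1"
    by (simp only: Complex.DeMoivre) simp
  show "Im (cis (2 * pi / 3)) \<noteq> 0"
    by (simp add: sin_120)
qed

lemma deriv_shift: "deriv (\<lambda>z. f (z + a)) z = deriv f (z + a)"
  unfolding deriv_def by (simp add: DERIV_shift)

lemma pseudo_factorial_egf_linear_analytic: "(\<lambda>z. pseudo_factorial_egf (isqrt3 * z)) analytic_on {0}"
proof -
  have "pseudo_factorial_egf holomorphic_on ball 0 1"
    unfolding holomorphic_on_open[OF open_ball]
  proof
    fix z :: complex assume "z \<in> ball 0 1"
    thus "\<exists>d. (pseudo_factorial_egf has_field_derivative d) (at z)"
      using has_field_derivative_pseudo_factorial_egf[of z] by auto
  qed
  hence an: "pseudo_factorial_egf analytic_on ball 0 1"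
    by (simp add: analytic_on_open)
  have "(\<lambda>z. isqrt3 * z) analytic_on {0}"
    by (intro analytic_intros)
  from analytic_on_compose_gen[OF this an] show ?thesis
    by (simp add: o_def)
qed

text \<open>
  Translating \<open>p\<close> so that its pole \<open>s\<close> moves to the origin gives a function \<open>P\<close> that, by uniqueness at
  the pole, is even and satisfies \<open>P(wz) = w P(z)\<close> for a cube root of unity \<open>w\<close>. Reflections in 0 and
  in \<open>s\<close> compose to the translation by \<open>2s\<close>, and the rotation provides the second period. A smaller real
  period \<open>q\<close> would give \<open>p\<close> a pole at \<open>q - s\<close>, which lies strictly between \<open>-s\<close> and \<open>s\<close>.
\<close>
lemma weierstrass_p_0_neg4:
  defines "s \<equiv> Beta (1/3) (1/2) / 2"
  obtains "\<And>z. weierstrass_p 0 (-4) (z + of_real (2 * s)) = weierstrass_p 0 (-4) z"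
    "\<And>q. 0 < q \<Longrightarrow> q < 2 * s \<Longrightarrow> \<exists>z. weierstrass_p 0 (-4) (z + of_real q) \<noteq> weierstrass_p 0 (-4) z"
    "eventually (\<lambda>w. weierstrass_p 0 (-4) (w + of_real s) = wp_seed w) (nhds 0)"
proof -
  obtain p where p: "wp_solution p" "eventually (\<lambda>w. p w = wp_seed w) (nhds 0)"
    "\<And>z. p (-z) = p z" "\<And>z. p (cnj z) = cnj (p z)"
    using wp_shifted_exists by blast
  have an0: "p analytic_on {0}"
    using analytic_at_cong[OF p(2) refl] wp_seed_analytic by simp
  have p0: "p 0 = -1"
    using eventually_nhds_x_imp_x[OF p(2)] by (simp add: wp_seed_0)
  have "eventually (\<lambda>z. eventually (\<lambda>w. p w = wp_seed w) (nhds z)) (nhds 0)"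
    using p(2) by (simp add: eventually_eventually)
  hence "eventually (\<lambda>z. deriv wp_seed z / z = deriv p z / z) (at 0)"
    by (intro eventually_nhds_imp_at) (auto elim!: eventually_mono intro!: arg_cong2[where f = "(/)"] deriv_cong_ev[symmetric])
  from Lim_transform_eventually[OF tendsto_deriv_wp_seed this]
  have p0': "(\<lambda>w. deriv p w / w) \<midarrow>0\<rightarrow> 6" .
  note first_pole = wp_shifted_first_pole[OF p(1,4) an0 p0 p0', folded s_def]
  have s_pos: "s > 0"
    unfolding s_def Beta_def by (simp add: Gamma_real_pos)

  define P where "P z = p (z + of_real s)" for z
  have P_sol: "wp_solution P"
    using wp_solution_affine[OF p(1), of 1 1 "of_real s"] by (simp add: P_def [abs_def])
  have "is_pole P 0"
    using is_pole_compose_affine[of 1 p "of_real s" 0] first_pole(1) by (simp add: P_def [abs_def])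
  hence P_lim: "(\<lambda>z. z\<^sup>2 * P z) \<midarrow>0\<rightarrow> 1"
    using wp_solution_pole[OF P_sol] by simp

  have lin: "filterlim (\<lambda>z. c * z) (at 0) (at 0)" if "c \<noteq> 0" for c :: complex
    using filtermap_affine_at[OF that, of 0 0] by (simp add: filterlim_def)

  have P_even: "P (-z) = P z" for z
  proof -
    have "(\<lambda>z. 1 * P (-1 * z + 0)) = P"
    proof (rule wp_solution_unique[OF wp_solution_affine[OF P_sol] P_sol _ P_lim])
      show "(\<lambda>z. z\<^sup>2 * (1 * P (-1 * z + 0))) \<midarrow>0\<rightarrow> 1"
        using filterlim_compose[OF P_lim lin[of "-1"]] by simp
    qed auto
    from fun_cong[OF this, of z] show ?thesis by simp
  qed
  have p_period: "p (z + 2 * of_real s) = p z" for z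
    using P_even[of "-(z + of_real s)"] p(3)[of z] by (simp add: P_def algebra_simps)
  have P_period: "P (z + 2 * of_real s) = P z" for z
    using p_period[of "z + of_real s"] by (simp add: P_def algebra_simps)

  obtain w :: complex where w: "w ^ 3 = 1" "Im w \<noteq> 0"
    using nonreal_cube_root_of_unity .
  hence w0: "w \<noteq> 0" by auto
  have w2: "(w\<^sup>2) ^ 3 = 1" "(w\<^sup>2 * w)\<^sup>2 = 1"
    using w(1) by algebra+
  have P_rot: "w\<^sup>2 * P (w * z) = P z" for z
  proof -
    have "(\<lambda>z. w\<^sup>2 * P (w * z + 0)) = P"
    proof (rule wp_solution_unique[OF wp_solution_affine[OF P_sol w2] P_sol _ P_lim])
      show "(\<lambda>z. z\<^sup>2 * (w\<^sup>2 * P (w * z + 0))) \<midarrow>0\<rightarrow> 1"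
        using filterlim_compose[OF P_lim lin[OF w0]] by (simp add: power_mult_distrib mult_ac)
    qed
    from fun_cong[OF this, of z] show ?thesis by simp
  qed
  have P_period': "P (z + 2 * of_real s * w) = P z" for z
  proof -
    have "w\<^sup>2 * P (w * (z / w + 2 * of_real s)) = w\<^sup>2 * P (w * (z / w))"
      unfolding P_rot by (rule P_period)
    thus ?thesis
      using w0 by (simp add: algebra_simps)
  qed

  have elliptic: "elliptic_function P"
    unfolding elliptic_function_def
  proof (intro conjI exI allI)
    show "P nicely_meromorphic_on UNIV"
      using P_sol by (simp add: wp_solution_def)
    show "2 * complex_of_real s \<noteq> 0" "Im (2 * of_real s * w / (2 * of_real s)) \<noteq> 0"
      using s_pos w(2) by simp_all
  qed (rule P_period P_period')+
  have wp: "weierstrass_p 0 (-4) = P"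
    unfolding weierstrass_p_def
  proof (rule the_equality, intro conjI allI impI)
    show "elliptic_function P" by fact
    show "(deriv P z)\<^sup>2 = 4 * P z ^ 3 - 0 * P z - -4" if "\<not> is_pole P z" for z
      using P_sol that by (simp add: wp_solution_def wp_ode_def)
    have "(\<lambda>z. P z / (1 / z\<^sup>2)) \<midarrow>0\<rightarrow> 1"
      using P_lim by (simp add: mult.commute)
    thus "P \<sim>[at 0] (\<lambda>z. 1 / z\<^sup>2)"
      by (rule asymp_equivI')
  next
    fix Q assume Q: "elliptic_function Q \<and>
       (\<forall>z. \<not> is_pole Q z \<longrightarrow> (deriv Q z)\<^sup>2 = 4 * Q z ^ 3 - 0 * Q z - -4) \<and> Q \<sim>[at 0] (\<lambda>z. 1 / z\<^sup>2)"
    have "((\<lambda>z. Q z / (1 / z\<^sup>2)) \<longlongrightarrow> 1) (at 0)"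
      using Q by (intro asymp_equivD_strong) (auto simp: eventually_at_filter)
    hence "(\<lambda>z. z\<^sup>2 * Q z) \<midarrow>0\<rightarrow> 1"
      by (simp add: mult.commute)
    moreover have "wp_solution Q"
      using Q by (simp add: wp_solution_def elliptic_function_def wp_ode_def)
    ultimately show "Q = P"
      using wp_solution_unique P_sol P_lim by blast
  qed

  show thesis
  proof (rule that)
    show "weierstrass_p 0 (-4) (z + of_real (2 * s)) = weierstrass_p 0 (-4) z" for z
      unfolding wp using P_period[of z] by simp
    have "P (w + of_real s) = p w" for w
      using p_period[of w] by (simp add: P_def add.assoc)
    thus "eventually (\<lambda>w. weierstrass_p 0 (-4) (w + of_real s) = wp_seed w) (nhds 0)"
      unfolding wp using p(2) by simp
  next
    fix q :: real assume q: "0 < q" "q < 2 * s"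
    show "\<exists>z. weierstrass_p 0 (-4) (z + of_real q) \<noteq> weierstrass_p 0 (-4) z"
    proof (rule ccontr)
      assume "\<not> ?thesis"
      hence period: "P (z + of_real q) = P z" for z
        unfolding wp by simp
      have "p (z + of_real (q - s)) = P z" for z
        using p_period[of "z + of_real (q - s)"] period[of z] by (simp add: P_def algebra_simps)
      hence "is_pole (\<lambda>z. p (1 * z + of_real (q - s))) 0"
        using \<open>is_pole P 0\<close> by simp
      hence "is_pole p (of_real (q - s))"
        by (subst (asm) is_pole_compose_affine) simp_all
      moreover have "is_pole p (of_real (- (q - s)))" if "is_pole p (of_real (q - s))"
        using that is_pole_compose_affine[of "-1" p 0 "of_real (- (q - s))"] by (simp add: p(3))
      ultimately have "is_pole p (of_real \<bar>q - s\<bar>)"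
        by (cases "q \<ge> s") (auto simp: abs_if)
      moreover have "\<not> is_pole p (of_real \<bar>q - s\<bar>)"
        by (rule first_pole(2)) (use q in auto)
      ultimately show False by contradiction
    qed
  qed
qed

theorem theorem2:
  fixes wp :: "complex \<Rightarrow> complex"
  defines "wp \<equiv> weierstrass_p 0 (-4)"
  shows "\<exists>r::real.
    smallest_positive_real_period wp (6 * r) \<and>
    6 * r = pi3 * 2 powr (-1/3) \<and>
    6 * r = 2 powr (-4/3) * 3 powr (1/2) / pi * Gamma (1/3) ^ 3 \<and>
    (\<lambda>z. pseudo_factorial_egf (\<i> * of_real (sqrt 3) * z)) analytic_on {0} \<and>
    (\<lambda>z. (- deriv wp (z + of_real (3 * r)) - 2 * \<i> * of_real (sqrt 3)) /
          (2 * \<i> * of_real (sqrt 3) * wp (z + of_real (3 * r)))) analytic_on {0} \<and>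
    (\<forall>\<^sub>F z in nhds 0.
       pseudo_factorial_egf (\<i> * of_real (sqrt 3) * z) =
       (- deriv wp (z + of_real (3 * r)) - 2 * \<i> * of_real (sqrt 3)) /
       (2 * \<i> * of_real (sqrt 3) * wp (z + of_real (3 * r))))"
proof -
  define s :: real where "s = Beta (1/3) (1/2) / 2"
  have wp: "\<And>z. wp (z + of_real (2 * s)) = wp z"
    "\<And>q. 0 < q \<Longrightarrow> q < 2 * s \<Longrightarrow> \<exists>z. wp (z + of_real q) \<noteq> wp z"
    "eventually (\<lambda>w. wp (w + of_real s) = wp_seed w) (nhds 0)"
    unfolding wp_def s_def using weierstrass_p_0_neg4 by blast+
  define r where "r = s / 3"
  have r: "3 * r = s" "6 * r = Beta (1/3) (1/2)"
    by (simp_all add: r_def s_def)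
  define rhs where "rhs z = (- deriv wp (z + of_real (3 * r)) - 2 * \<i> * of_real (sqrt 3)) /
       (2 * \<i> * of_real (sqrt 3) * wp (z + of_real (3 * r)))" for z
  have period: "smallest_positive_real_period wp (6 * r)"
    unfolding smallest_positive_real_period_def
  proof (intro conjI allI impI)
    show "6 * r > 0"
      unfolding r Beta_def by (simp add: Gamma_real_pos)
    show "wp (z + of_real (6 * r)) = wp z" for z
      using wp(1)[of z] by (simp add: r_def)
    show "6 * r \<le> q" if "q > 0 \<and> (\<forall>z. wp (z + of_real q) = wp z)" for q
      using wp(2)[of q] that by (force simp: r_def)
  qed
  have pi3: "6 * r = pi3 * 2 powr (-1/3)"
    unfolding r pi3_eq_Beta Beta_third_half by simp
  have gamma: "6 * r = 2 powr (-4/3) * 3 powr (1/2) / pi * Gamma (1/3) ^ 3"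
  proof -
    have "2 powr (-4/3) = 2 powr (-1/3) * (2::real) powr (-1)"
      by (subst powr_add[symmetric]) simp
    hence two: "(2::real) powr (-4/3) = 2 powr (-1/3) / 2"
      by (simp add: powr_minus_divide)
    show ?thesis
      unfolding r Beta_third_half Beta_third_third two by (simp add: powr_half_sqrt)
  qed
  have egf: "eventually (\<lambda>z. pseudo_factorial_egf (\<i> * of_real (sqrt 3) * z) = rhs z) (nhds 0)"
  proof -
    have "eventually (\<lambda>z. eventually (\<lambda>w. wp (w + of_real s) = wp_seed w) (nhds z)) (nhds 0)"
      using wp(3) by (simp add: eventually_eventually)
    thus ?thesis
      using wp(3) eventually_wp_seed_regular
    proof eventually_elim
      case (elim z)
      have "deriv wp (z + of_real s) = deriv wp_seed z"
        unfolding deriv_shift[symmetric] using elim(1) by (rule deriv_cong_ev) simp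
      thus ?case
        using pseudo_factorial_egf_eq_wp_seed[of z] elim(2,3)
        by (simp add: rhs_def r isqrt3_def mult.assoc)
    qed
  qed
  have an: "(\<lambda>z. pseudo_factorial_egf (\<i> * of_real (sqrt 3) * z)) analytic_on {0}"
    using pseudo_factorial_egf_linear_analytic by (simp add: isqrt3_def)
  moreover from this have "rhs analytic_on {0}"
    using analytic_at_cong[OF egf refl] by simp
  ultimately show ?thesis
    using period pi3 gamma egf unfolding rhs_def [abs_def] by blast
qed

end
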